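(* Let $A$ be a DMV-algebra. Then there exists a unique divisible l-group $G$ together with a strong unit $u$ for $G$ such that $A=\{x\in G\mid 0\le x\le u\}$, in the sense that the MV-reduct $A^*$ is the MV-algebra $\mathbf{\Gamma}(G,u)$. (Identity $A^*=\mathbf{\Gamma}(G,u)$ is up to isomorphism of MV-algebras, and uniqueness of $(G,u)$ is up to isomorphism of l-groups preserving the strong unit.)
   Context: An MV-algebra is a structure $(A,\oplus,\neg,0,1)$ satisfying: $x\oplus(y\oplus z)=(x\oplus y)\oplus z$; $x\oplus y=y\oplus x$; $x\oplus 0=x$; $x\oplus 1=1$; $\neg 0=1$; $\neg 1=0$; $\neg(\neg x\oplus y)\oplus y=\neg(\neg y\oplus x)\oplus x$. One sets $x\odot y=\neg(\neg x\oplus\neg y)$. For $x\in A$ and $n\ge 0$, $n.x\in A$ is defined by $0.x=0$ and $n.x=(n-1).x\oplus x$. A DMV-algebra is a structure $A=(A,\oplus,\neg,\{\delta_n\}_{n\ge 1},0,1)$, each $\delta_n$ being a unary operation, such that $A^*=(A,\oplus,\neg,0,1)$ is an MV-algebra (the MV-reduct) and for every $x\in A$ and every integer $n\ge 1$: (D1n) $n.\delta_n x=x$; (D2n) $\delta_n x\odot (n-1).\delta_n x=0$. An l-group is an abelian group $G$ with a lattice structure such that $c+(a\wedge b)=(c+a)\wedge(c+b)$ for all $a,b,c\in G$; it is divisible if for every $x\in G$ and integer $m\ge 1$ there is $y\in G$ with $my=x$. A strong unit is an element $u\in G$ such that for every $x\in G$ there is $n\in\mathbb{N}$ with $nu\ge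 x$. $\mathbf{\Gamma}(G,u)$ is the MV-algebra on $\{x\in G\mid 0\le x\le u\}$ with $x\oplus y=u\wedge(x+y)$, $\neg x=u-x$, zero $0$ and unit $u$. *)

theory Defs
  imports "HOL-Algebra.Group"
begin

section \<open>MV-algebras and DMV-algebras\<close>

record 'a mv = "'a partial_object" +
  mv_plus :: "['a, 'a] \<Rightarrow> 'a" (infixl "\<oplus>\<index>" 65)
  mv_neg :: "'a \<Rightarrow> 'a"
  mv_zero :: 'a
  mv_one :: 'a

definition mv_times :: "('a, 'm) mv_scheme \<Rightarrow> 'a \<Rightarrow> 'a \<Rightarrow> 'a" (infixl "\<odot>\<index>" 70) where
  "x \<odot>\<^bsub>A\<^esub> y = mv_neg A (mv_neg A x \<oplus>\<^bsub>A\<^esub> mv_neg A y)"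

primrec mv_multiple :: "('a, 'm) mv_scheme \<Rightarrow> nat \<Rightarrow> 'a \<Rightarrow> 'a" where
  "mv_multiple A 0 x = mv_zero A"
| "mv_multiple A (Suc n) x = mv_multiple A n x \<oplus>\<^bsub>A\<^esub> x"

locale mv_algebra =
  fixes A :: "('a, 'm) mv_scheme" (structure)
  assumes plus_closed [simp, intro]: "\<lbrakk>x \<in> carrier A; y \<in> carrier A\<rbrakk> \<Longrightarrow> x \<oplus> y \<in> carrier A"
    and neg_closed [simp, intro]: "x \<in> carrier A \<Longrightarrow> mv_neg A x \<in> carrier A"
    and zero_closed [simp, intro]: "mv_zero A \<in> carrier A"
    and one_closed [simp, intro]: "mv_one A \<in> carrier A"
    and plus_assoc:
      "\<lbrakk>x \<in> carrier A; y \<in> carrier A; z \<in> carrier A\<rbrakk> \<Longrightarrow> x \<oplus> (y \<oplus> z) = (x \<oplus> y) \<oplus> z"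
    and plus_comm: "\<lbrakk>x \<in> carrier A; y \<in> carrier A\<rbrakk> \<Longrightarrow> x \<oplus> y = y \<oplus> x"
    and plus_zero: "x \<in> carrier A \<Longrightarrow> x \<oplus> mv_zero A = x"
    and plus_one: "x \<in> carrier A \<Longrightarrow> x \<oplus> mv_one A = mv_one A"
    and neg_zero: "mv_neg A (mv_zero A) = mv_one A"
    and neg_one: "mv_neg A (mv_one A) = mv_zero A"
    and lukasiewicz:
      "\<lbrakk>x \<in> carrier A; y \<in> carrier A\<rbrakk> \<Longrightarrow>
        mv_neg A (mv_neg A x \<oplus> y) \<oplus> y = mv_neg A (mv_neg A y \<oplus> x) \<oplus> x"

text \<open>The family of operations is indexed by all of \<^typ>\<open>nat\<close>, but only the operations
  with index at least 1 are part of the structure: nothing is assumed about index 0.\<close>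

record 'a dmv = "'a mv" +
  mv_delta :: "nat \<Rightarrow> 'a \<Rightarrow> 'a"

locale dmv_algebra = mv_algebra A for A :: "('a, 'm) dmv_scheme" (structure) +
  assumes delta_closed [simp, intro]:
      "\<lbrakk>1 \<le> n; x \<in> carrier A\<rbrakk> \<Longrightarrow> mv_delta A n x \<in> carrier A"
    and D1: "\<lbrakk>1 \<le> n; x \<in> carrier A\<rbrakk> \<Longrightarrow> mv_multiple A n (mv_delta A n x) = x"
    and D2: "\<lbrakk>1 \<le> n; x \<in> carrier A\<rbrakk> \<Longrightarrow>
      mv_delta A n x \<odot> mv_multiple A (n - 1) (mv_delta A n x) = mv_zero A"

definition mv_reduct :: "('a, 'm) mv_scheme \<Rightarrow> 'a mv" where
  "mv_reduct A = mv.truncate A"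

definition mv_iso :: "('a, 'm) mv_scheme \<Rightarrow> ('b, 'n) mv_scheme \<Rightarrow> ('a \<Rightarrow> 'b) set" where
  "mv_iso A B = {f. bij_betw f (carrier A) (carrier B)
    \<and> (\<forall>x\<in>carrier A. \<forall>y\<in>carrier A. f (x \<oplus>\<^bsub>A\<^esub> y) = f x \<oplus>\<^bsub>B\<^esub> f y)
    \<and> (\<forall>x\<in>carrier A. f (mv_neg A x) = mv_neg B (f x))
    \<and> f (mv_zero A) = mv_zero B
    \<and> f (mv_one A) = mv_one B}"

section \<open>Lattice-ordered abelian groups\<close>

text \<open>Groups are written multiplicatively, as in \<^locale>\<open>comm_group\<close>: the group operation
  \<open>x + y\<close> of the additive notation is \<open>x \<otimes>\<^bsub>G\<^esub> y\<close>, the neutral element \<open>0\<close> is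
  \<open>\<one>\<^bsub>G\<^esub>\<close>, the difference \<open>u - x\<close> is \<open>u \<otimes>\<^bsub>G\<^esub> inv\<^bsub>G\<^esub> x\<close>, and the multiple \<open>n x\<close> is
  \<open>x [^]\<^bsub>G\<^esub> n\<close>.\<close>

record 'a lgroup = "'a monoid" +
  lg_le :: "['a, 'a] \<Rightarrow> bool"

definition lg_order :: "('a, 'm) lgroup_scheme \<Rightarrow> 'a gorder" where
  "lg_order G = \<lparr>carrier = carrier G, eq = (=), le = lg_le G\<rparr>"

abbreviation lg_meet :: "('a, 'm) lgroup_scheme \<Rightarrow> 'a \<Rightarrow> 'a \<Rightarrow> 'a" where
  "lg_meet G x y \<equiv> x \<sqinter>\<^bsub>lg_order G\<^esub> y"

abbreviation lg_join :: "('a, 'm) lgroup_scheme \<Rightarrow> 'a \<Rightarrow> 'a \<Rightarrow> 'a" where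
  "lg_join G x y \<equiv> x \<squnion>\<^bsub>lg_order G\<^esub> y"

locale l_group = comm_group G for G :: "('a, 'm) lgroup_scheme" (structure) +
  assumes lattice_order: "lattice (lg_order G)"
    and mult_meet_distrib: "\<lbrakk>a \<in> carrier G; b \<in> carrier G; c \<in> carrier G\<rbrakk> \<Longrightarrow>
      c \<otimes> lg_meet G a b = lg_meet G (c \<otimes> a) (c \<otimes> b)"

locale divisible_l_group = l_group G for G :: "('a, 'm) lgroup_scheme" (structure) +
  assumes divisible: "\<lbrakk>x \<in> carrier G; 1 \<le> (m :: nat)\<rbrakk> \<Longrightarrow> \<exists>y\<in>carrier G. y [^] m = x"

definition strong_unit :: "('a, 'm) lgroup_scheme \<Rightarrow> 'a \<Rightarrow> bool" where
  "strong_unit G u \<longleftrightarrow>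
    u \<in> carrier G \<and> (\<forall>x\<in>carrier G. \<exists>n :: nat. lg_le G x (u [^]\<^bsub>G\<^esub> n))"

definition lg_iso :: "('a, 'm) lgroup_scheme \<Rightarrow> ('b, 'n) lgroup_scheme \<Rightarrow> ('a \<Rightarrow> 'b) set" where
  "lg_iso G H = {f. f \<in> iso G H
    \<and> (\<forall>x\<in>carrier G. \<forall>y\<in>carrier G. f (lg_meet G x y) = lg_meet H (f x) (f y))
    \<and> (\<forall>x\<in>carrier G. \<forall>y\<in>carrier G. f (lg_join G x y) = lg_join H (f x) (f y))}"

definition Gamma :: "('a, 'm) lgroup_scheme \<Rightarrow> 'a \<Rightarrow> 'a mv" where
  "Gamma G u =
    \<lparr>carrier = {x \<in> carrier G. lg_le G \<one>\<^bsub>G\<^esub> x \<and> lg_le G x u},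
     mv_plus = (\<lambda>x y. lg_meet G u (x \<otimes>\<^bsub>G\<^esub> y)),
     mv_neg = (\<lambda>x. u \<otimes>\<^bsub>G\<^esub> inv\<^bsub>G\<^esub> x),
     mv_zero = \<one>\<^bsub>G\<^esub>,
     mv_one = u\<rparr>"

definition enveloping_divisible_l_group ::
    "('a, 'k) dmv_scheme \<Rightarrow> ('b, 'm) lgroup_scheme \<Rightarrow> 'b \<Rightarrow> bool" where
  "enveloping_divisible_l_group A G u \<longleftrightarrow>
    divisible_l_group G \<and> strong_unit G u \<and> mv_iso (mv_reduct A) (Gamma G u) \<noteq> {}"

text \<open>HOL cannot quantify over types inside a formula, so an existence statement has to name a
  type in which the group lives. Each element of the group is an \<open>n\<close>-fold multiple of a
  difference \<open>a - b\<close> of elements of the algebra, so sets of triples \<open>(n, a, b)\<close>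
  leave enough room; the type prescribes nothing about how the group is built.\<close>

type_synonym 'a envelope = "(nat \<times> 'a \<times> 'a) set"

end

theory Submission
  imports Defs
begin

text \<open>
  The proof rests on one idea. If \<open>A\<close> is the unit interval \<open>[0, u]\<close> of a divisible l-group \<open>G\<close>,
  then \<open>x \<mapsto> 2x - u\<close> stretches \<open>A\<close> to the symmetric interval \<open>[-u, u]\<close>, and \<open>e n x = 2^n (2x - u)\<close>
  maps \<open>A\<close> onto \<open>[-2^n u, 2^n u]\<close>; because \<open>u\<close> is a strong unit, these intervals exhaust \<open>G\<close>.
  In these coordinates all of \<open>G\<close> can be read off from \<open>A\<close> alone, in terms of the midpoint
  \<open>avg x y = (x + y)/2\<close>, which is never truncated and is available in a DMV-algebra as
  \<open>\<delta>\<^sub>2 x \<oplus> \<delta>\<^sub>2 y\<close>. Writing \<open>mid\<close> for \<open>u/2\<close>,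

  \<^item> \<open>e n x = e (n + 1) (avg x mid)\<close>,

  \<^item> \<open>e n x + e n y = e (n + 1) (avg x y)\<close>,

  \<^item> \<open>e n x \<le> e n y\<close> if and only if \<open>x \<le> y\<close>.

  These three rules together with surjectivity are the locale \<open>dyadic_coordinates\<close>.

  Uniqueness follows at once. Every enveloping group has such coordinates
  (\<open>enveloping_dyadic\<close>), and two groups with coordinates over the same algebra are isomorphic by
  \<open>e n x \<mapsto> e' n x\<close> (\<open>dyadic_coordinates_unique\<close>), since the rules determine when two pairs
  \<open>(n, x)\<close> denote the same element, what their sum is and how they compare. The unit is \<open>e 0 1\<close>.

  For existence, the rules are turned into a definition: \<open>G\<close> is the direct limit of the chain
  \<open>A \<rightarrow> A \<rightarrow> A \<rightarrow> \<dots>\<close> along the contraction \<open>x \<mapsto> avg x mid\<close>. The group laws reduce to laws of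
  midpoints: \<open>avg\<close> is commutative, idempotent, medial (\<open>avg_medial\<close>) and order-cancellative, and
  \<open>avg x (\<not> x) = mid\<close>. The order of \<open>G\<close> is a lattice because a contraction preserves meets and
  joins, its image being an interval (\<open>avg_interval\<close>). The embedding of \<open>A\<close> sends \<open>a\<close> to
  \<open>e 0 (avg a 1)\<close>, which stands for \<open>2 (a + u)/2 - u = a\<close>. Only here do the operations \<open>\<delta>\<^sub>n\<close> with
  arbitrary \<open>n\<close> enter: they make the image of \<open>A\<close>, and then the group it generates, divisible.

  Inside the MV-algebra everything depends on the uniqueness of halves (\<open>double_le_cancel\<close>),
  the counterpart of the fact that an l-group is torsion-free.
\<close>

section \<open>Order and partial addition in MV-algebras\<close>

definition mv_le :: "('a, 'm) mv_scheme \<Rightarrow> 'a \<Rightarrow> 'a \<Rightarrow> bool" (infix "\<preceq>\<index>" 50) where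
  "x \<preceq>\<^bsub>A\<^esub> y \<longleftrightarrow> mv_neg A x \<oplus>\<^bsub>A\<^esub> y = mv_one A"

definition mv_join :: "('a, 'm) mv_scheme \<Rightarrow> 'a \<Rightarrow> 'a \<Rightarrow> 'a" where
  "mv_join A x y = mv_neg A (mv_neg A x \<oplus>\<^bsub>A\<^esub> y) \<oplus>\<^bsub>A\<^esub> y"

definition mv_meet :: "('a, 'm) mv_scheme \<Rightarrow> 'a \<Rightarrow> 'a \<Rightarrow> 'a" where
  "mv_meet A x y = mv_neg A (mv_join A (mv_neg A x) (mv_neg A y))"

text \<open>Truncated subtraction, left adjoint to addition: \<open>x \<ominus> y \<preceq> z\<close> if and only if
  \<open>x \<preceq> y \<oplus> z\<close>.\<close>
definition mv_minus :: "('a, 'm) mv_scheme \<Rightarrow> 'a \<Rightarrow> 'a \<Rightarrow> 'a" (infixl "\<ominus>\<index>" 65) where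
  "x \<ominus>\<^bsub>A\<^esub> y = mv_neg A (mv_neg A x \<oplus>\<^bsub>A\<^esub> y)"

context mv_algebra
begin

abbreviation neg ("\<sim> _" [81] 80) where "\<sim> x \<equiv> mv_neg A x"
abbreviation zro ("\<zero>\<^sub>A") where "\<zero>\<^sub>A \<equiv> mv_zero A"
abbreviation uno ("\<one>\<^sub>A") where "\<one>\<^sub>A \<equiv> mv_one A"

lemma plus_lcomm:
  "\<lbrakk>x \<in> carrier A; y \<in> carrier A; z \<in> carrier A\<rbrakk> \<Longrightarrow> x \<oplus> (y \<oplus> z) = y \<oplus> (x \<oplus> z)"
  by (metis plus_assoc plus_comm)

lemmas plus_ac = plus_assoc [symmetric] plus_comm plus_lcomm

lemma zero_plus: "x \<in> carrier A \<Longrightarrow> \<zero>\<^sub>A \<oplus> x = x"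
  by (metis plus_comm plus_zero zero_closed)

lemma one_plus: "x \<in> carrier A \<Longrightarrow> \<one>\<^sub>A \<oplus> x = \<one>\<^sub>A"
  by (metis plus_comm plus_one one_closed)

lemma neg_neg [simp]: "x \<in> carrier A \<Longrightarrow> \<sim> (\<sim> x) = x"
  using lukasiewicz [of x "\<zero>\<^sub>A"] by (simp add: plus_zero neg_zero one_plus neg_one zero_plus)

lemma neg_plus: "x \<in> carrier A \<Longrightarrow> \<sim> x \<oplus> x = \<one>\<^sub>A"
  using lukasiewicz [of x "\<one>\<^sub>A"] by (simp add: plus_one neg_one zero_plus)

lemma plus_neg: "x \<in> carrier A \<Longrightarrow> x \<oplus> \<sim> x = \<one>\<^sub>A"
  using plus_comm [of x "\<sim> x"] by (simp add: neg_plus)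

lemma le_refl [simp]: "x \<in> carrier A \<Longrightarrow> x \<preceq> x"
  by (simp add: mv_le_def neg_plus)

lemma le_plus [simp]: "\<lbrakk>x \<in> carrier A; y \<in> carrier A\<rbrakk> \<Longrightarrow> x \<preceq> x \<oplus> y"
  by (simp add: mv_le_def plus_assoc neg_plus one_plus)

lemma le_plus_left [simp]: "\<lbrakk>x \<in> carrier A; y \<in> carrier A\<rbrakk> \<Longrightarrow> y \<preceq> x \<oplus> y"
  by (metis le_plus plus_comm)

lemma minus_closed [simp]: "\<lbrakk>x \<in> carrier A; y \<in> carrier A\<rbrakk> \<Longrightarrow> x \<ominus> y \<in> carrier A"
  by (simp add: mv_minus_def)

lemma join_closed [simp]: "\<lbrakk>x \<in> carrier A; y \<in> carrier A\<rbrakk> \<Longrightarrow> mv_join A x y \<in> carrier A"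
  by (simp add: mv_join_def)

lemma meet_closed [simp]: "\<lbrakk>x \<in> carrier A; y \<in> carrier A\<rbrakk> \<Longrightarrow> mv_meet A x y \<in> carrier A"
  by (simp add: mv_meet_def)

lemma join_comm: "\<lbrakk>x \<in> carrier A; y \<in> carrier A\<rbrakk> \<Longrightarrow> mv_join A x y = mv_join A y x"
  by (simp add: mv_join_def lukasiewicz)

lemma join_minus: "\<lbrakk>x \<in> carrier A; y \<in> carrier A\<rbrakk> \<Longrightarrow> mv_join A x y = (x \<ominus> y) \<oplus> y"
  by (simp add: mv_join_def mv_minus_def)

lemma join_absorb: "\<lbrakk>x \<in> carrier A; y \<in> carrier A; x \<preceq> y\<rbrakk> \<Longrightarrow> mv_join A x y = y"
  by (simp add: mv_join_def mv_le_def neg_one zero_plus)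

lemma le_antisym: "\<lbrakk>x \<in> carrier A; y \<in> carrier A; x \<preceq> y; y \<preceq> x\<rbrakk> \<Longrightarrow> x = y"
  by (metis join_absorb join_comm)

text \<open>Since \<open>(x \<ominus> y) \<oplus> y\<close> is the join of \<open>x\<close> and \<open>y\<close>, the order is the algebraic one:
  whatever lies above \<open>y\<close> is a sum with summand \<open>y\<close>.\<close>
lemma minus_plus_cancel: "\<lbrakk>x \<in> carrier A; y \<in> carrier A; y \<preceq> x\<rbrakk> \<Longrightarrow> (x \<ominus> y) \<oplus> y = x"
  by (metis join_absorb join_comm join_minus)

lemma le_trans:
  "\<lbrakk>x \<in> carrier A; y \<in> carrier A; z \<in> carrier A; x \<preceq> y; y \<preceq> z\<rbrakk> \<Longrightarrow> x \<preceq> z"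
  by (metis le_plus_left minus_closed minus_plus_cancel plus_closed plus_assoc)

lemma plus_mono_left:
  assumes "x \<in> carrier A" "y \<in> carrier A" "z \<in> carrier A" "x \<preceq> y"
  shows "x \<oplus> z \<preceq> y \<oplus> z"
proof -
  have "y \<oplus> z = (y \<ominus> x) \<oplus> (x \<oplus> z)"
    using assms by (simp add: plus_assoc minus_plus_cancel)
  then show ?thesis using assms by simp
qed

lemma plus_mono:
  assumes "x \<in> carrier A" "y \<in> carrier A" "z \<in> carrier A" "w \<in> carrier A" "x \<preceq> y" "z \<preceq> w"
  shows "x \<oplus> z \<preceq> y \<oplus> w"
proof (rule le_trans [of _ "y \<oplus> z"])
  show "x \<oplus> z \<preceq> y \<oplus> z" using assms by (simp add: plus_mono_left)
  show "y \<oplus> z \<preceq> y \<oplus> w" using assms plus_mono_left [of z w y] by (simp add: plus_comm)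
qed (use assms in simp_all)

lemma neg_le_neg_iff: "\<lbrakk>x \<in> carrier A; y \<in> carrier A\<rbrakk> \<Longrightarrow> \<sim> x \<preceq> \<sim> y \<longleftrightarrow> y \<preceq> x"
  by (simp add: mv_le_def plus_comm)

lemma zero_le [simp]: "x \<in> carrier A \<Longrightarrow> \<zero>\<^sub>A \<preceq> x"
  by (simp add: mv_le_def neg_zero one_plus)

lemma le_one [simp]: "x \<in> carrier A \<Longrightarrow> x \<preceq> \<one>\<^sub>A"
  by (simp add: mv_le_def plus_one)

lemma minus_le_iff:
  "\<lbrakk>x \<in> carrier A; y \<in> carrier A; z \<in> carrier A\<rbrakk> \<Longrightarrow> x \<ominus> y \<preceq> z \<longleftrightarrow> x \<preceq> y \<oplus> z"
  by (simp add: mv_le_def mv_minus_def plus_assoc)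

lemma join_upper1: "\<lbrakk>x \<in> carrier A; y \<in> carrier A\<rbrakk> \<Longrightarrow> x \<preceq> mv_join A x y"
  by (metis join_comm join_minus le_plus_left minus_closed)

lemma join_upper2: "\<lbrakk>x \<in> carrier A; y \<in> carrier A\<rbrakk> \<Longrightarrow> y \<preceq> mv_join A x y"
  by (simp add: join_minus)

lemma join_least:
  assumes "x \<in> carrier A" "y \<in> carrier A" "z \<in> carrier A" "x \<preceq> z" "y \<preceq> z"
  shows "mv_join A x y \<preceq> z"
proof -
  have "x \<preceq> y \<oplus> (z \<ominus> y)"
    using assms minus_plus_cancel [of z y] by (simp add: plus_comm)
  then have "x \<ominus> y \<preceq> z \<ominus> y"
    using assms by (simp add: minus_le_iff)
  then show ?thesis
    using assms plus_mono_left [of "x \<ominus> y" "z \<ominus> y" y]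
    by (simp add: join_minus minus_plus_cancel)
qed

lemma meet_lower1: "\<lbrakk>x \<in> carrier A; y \<in> carrier A\<rbrakk> \<Longrightarrow> mv_meet A x y \<preceq> x"
  using join_upper1 [of "\<sim> x" "\<sim> y"] neg_le_neg_iff [of x "mv_meet A x y"]
  by (simp add: mv_meet_def)

lemma meet_lower2: "\<lbrakk>x \<in> carrier A; y \<in> carrier A\<rbrakk> \<Longrightarrow> mv_meet A x y \<preceq> y"
  using join_upper2 [of "\<sim> x" "\<sim> y"] neg_le_neg_iff [of y "mv_meet A x y"]
  by (simp add: mv_meet_def)

lemma meet_greatest:
  assumes "x \<in> carrier A" "y \<in> carrier A" "z \<in> carrier A" "z \<preceq> x" "z \<preceq> y"
  shows "z \<preceq> mv_meet A x y"
  using assms join_least [of "\<sim> x" "\<sim> y" "\<sim> z"] neg_le_neg_iff [of "mv_meet A x y" z]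
  by (simp add: mv_meet_def neg_le_neg_iff)

text \<open>The condition \<open>x \<preceq> \<sim> y\<close> (orthogonality, equivalent to \<open>x \<odot> y = 0\<close>) says that the sum of
  \<open>x\<close> and \<open>y\<close> is not truncated at \<open>1\<close>. Under this condition \<open>\<oplus>\<close> behaves like the addition of the
  group that is to be constructed.\<close>

lemma orthogonal_sym: "\<lbrakk>x \<preceq> \<sim> y; x \<in> carrier A; y \<in> carrier A\<rbrakk> \<Longrightarrow> y \<preceq> \<sim> x"
  by (simp add: mv_le_def plus_comm)

text \<open>Dually to \<open>minus_plus_cancel\<close>, an untruncated sum can be undone. Hence such sums
  obey the cancellation law of an ordered group.\<close>
lemma plus_minus_cancel:
  assumes "x \<in> carrier A" "y \<in> carrier A" "x \<preceq> \<sim> y"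
  shows "(x \<oplus> y) \<ominus> y = x"
proof -
  have "\<sim> x = \<sim> (x \<oplus> y) \<oplus> y"
    using assms minus_plus_cancel [of "\<sim> x" y] orthogonal_sym [of x y]
    by (simp add: mv_minus_def)
  then have "x = \<sim> (\<sim> (x \<oplus> y) \<oplus> y)"
    using assms(1) neg_neg by metis
  then show ?thesis by (simp add: mv_minus_def)
qed

lemma plus_le_cancel:
  assumes "x \<in> carrier A" "y \<in> carrier A" "z \<in> carrier A" "x \<preceq> \<sim> z" "x \<oplus> z \<preceq> y \<oplus> z"
  shows "x \<preceq> y"
proof -
  have "(x \<oplus> z) \<ominus> z \<preceq> y"
    using assms by (simp add: minus_le_iff plus_comm)
  then show ?thesis using assms by (simp add: plus_minus_cancel)
qed

text \<open>With \<open>orthogonal_sym\<close>, this makes the untruncated sum an associative partial operation: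
  if one bracketing is defined, so is the other.\<close>
lemma orthogonal_assoc:
  assumes "x \<in> carrier A" "y \<in> carrier A" "z \<in> carrier A" "x \<preceq> \<sim> y" "x \<oplus> y \<preceq> \<sim> z"
  shows "x \<preceq> \<sim> (y \<oplus> z)"
proof -
  have "y \<preceq> \<sim> x"
    using assms orthogonal_sym by blast
  then have eq: "\<sim> (x \<oplus> y) \<oplus> y = \<sim> x"
    using assms minus_plus_cancel [of "\<sim> x" y] by (simp add: mv_minus_def)
  have "z \<preceq> \<sim> (x \<oplus> y)"
    using assms orthogonal_sym by blast
  then have "z \<oplus> y \<preceq> \<sim> (x \<oplus> y) \<oplus> y"
    using assms by (simp add: plus_mono_left)
  then have "x \<preceq> \<sim> (z \<oplus> y)"
    unfolding eq using assms orthogonal_sym by blast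
  then show ?thesis
    using assms plus_comm by metis
qed

lemma orthogonal_mono:
  assumes "x \<in> carrier A" "y \<in> carrier A" "z \<in> carrier A" "x \<preceq> y" "y \<preceq> \<sim> z"
  shows "x \<preceq> \<sim> z"
  using assms le_trans neg_closed by blast

text \<open>A definable sum of four terms remains definable after the two middle terms are exchanged.
  This is what lets halves be added termwise.\<close>
lemma orthogonal_interchange:
  assumes cl: "a \<in> carrier A" "b \<in> carrier A" "c \<in> carrier A" "d \<in> carrier A"
    and ab: "a \<preceq> \<sim> b" and cd: "c \<preceq> \<sim> d" and sum: "a \<oplus> b \<preceq> \<sim> (c \<oplus> d)"
  shows "a \<oplus> c \<preceq> \<sim> (b \<oplus> d)"
proof -
  have "a \<preceq> \<sim> (b \<oplus> (c \<oplus> d))"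
    using cl ab sum by (simp add: orthogonal_assoc)
  then have "b \<oplus> (c \<oplus> d) \<preceq> \<sim> a"
    by (rule orthogonal_sym) (use cl in simp_all)
  moreover have "b \<oplus> (c \<oplus> d) = (b \<oplus> d) \<oplus> c"
    using cl by (simp add: plus_ac)
  ultimately have bdca: "(b \<oplus> d) \<oplus> c \<preceq> \<sim> a"
    by simp
  have "b \<preceq> \<sim> (c \<oplus> d)"
    by (rule orthogonal_mono [of _ "a \<oplus> b"]) (use cl sum in simp_all)
  then have "c \<oplus> d \<preceq> \<sim> b"
    by (rule orthogonal_sym) (use cl in simp_all)
  then have "c \<preceq> \<sim> (d \<oplus> b)"
    using cl cd by (simp add: orthogonal_assoc)
  then have "b \<oplus> d \<preceq> \<sim> c"
    using cl orthogonal_sym [of c "d \<oplus> b"] plus_comm [of d b] by simp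
  then have "b \<oplus> d \<preceq> \<sim> (c \<oplus> a)"
    using cl bdca by (simp add: orthogonal_assoc)
  then have "c \<oplus> a \<preceq> \<sim> (b \<oplus> d)"
    by (rule orthogonal_sym) (use cl in simp_all)
  then show ?thesis
    using cl plus_comm [of c a] by simp
qed

section \<open>Halves are unique\<close>

text \<open>If \<open>x\<close> and \<open>y\<close> are disjoint, then the part of \<open>w\<close> exceeding \<open>z\<close> lies below both of them
  and vanishes.\<close>
lemma disjoint_plus:
  assumes cl: "x \<in> carrier A" "y \<in> carrier A" "z \<in> carrier A" "w \<in> carrier A"
    and disj: "\<And>v. \<lbrakk>v \<in> carrier A; v \<preceq> x; v \<preceq> y\<rbrakk> \<Longrightarrow> v = \<zero>\<^sub>A"
    and wx: "w \<preceq> x" and wyz: "w \<preceq> y \<oplus> z"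
  shows "w \<preceq> z"
proof -
  have "w \<ominus> z = \<zero>\<^sub>A"
  proof (rule disj)
    show "w \<ominus> z \<preceq> x"
      using cl wx le_trans [of w x "z \<oplus> x"] by (simp add: minus_le_iff)
    show "w \<ominus> z \<preceq> y"
      using cl wyz plus_comm [of y z] by (simp add: minus_le_iff)
  qed (use cl in simp)
  then have "w \<ominus> z \<preceq> \<zero>\<^sub>A" by simp
  then show ?thesis using cl by (simp add: minus_le_iff plus_zero)
qed

text \<open>Removing from \<open>x\<close> and \<open>y\<close> their common part leaves disjoint remainders: anything below both
  could be added to the meet.\<close>
lemma minus_disjoint:
  assumes "x \<in> carrier A" "y \<in> carrier A" "v \<in> carrier A"
    and "v \<preceq> x \<ominus> mv_meet A x y" "v \<preceq> y \<ominus> mv_meet A x y"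
  shows "v = \<zero>\<^sub>A"
proof -
  let ?m = "mv_meet A x y"
  have m: "?m \<in> carrier A" using assms by simp
  have "v \<oplus> ?m \<preceq> x" "v \<oplus> ?m \<preceq> y"
    using assms plus_mono_left [OF _ _ m assms(4)] plus_mono_left [OF _ _ m assms(5)]
    by (simp_all add: minus_plus_cancel meet_lower1 meet_lower2)
  then have "v \<oplus> ?m \<preceq> \<zero>\<^sub>A \<oplus> ?m"
    using assms m by (simp add: meet_greatest zero_plus)
  moreover have "v \<preceq> \<sim> ?m"
  proof (rule le_trans [OF _ _ _ assms(4)])
    show "x \<ominus> ?m \<preceq> \<sim> ?m"
      using assms m by (simp add: minus_le_iff plus_neg)
  qed (use assms in simp_all)
  ultimately have "v \<preceq> \<zero>\<^sub>A" using assms m plus_le_cancel by blast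
  then show ?thesis using assms le_antisym by simp
qed

text \<open>Split \<open>x = d + m\<close> and \<open>y = e + m\<close> over the common part \<open>m\<close>. Cancelling \<open>2m\<close> from
  \<open>2x \<le> 2y\<close> leaves \<open>d \<le> 2e\<close>, and \<open>d\<close> and \<open>e\<close> are disjoint, so \<open>d = 0\<close>. Orthogonality of \<open>x\<close> to
  itself is what makes the cancellations legitimate.\<close>
lemma double_le_cancel:
  assumes x: "x \<in> carrier A" and y: "y \<in> carrier A"
    and orth: "x \<preceq> \<sim> x" and le: "x \<oplus> x \<preceq> y \<oplus> y"
  shows "x \<preceq> y"
proof -
  define m where "m = mv_meet A x y"
  define d where "d = x \<ominus> m"
  define e where "e = y \<ominus> m"
  have cl [simp]: "m \<in> carrier A" "d \<in> carrier A" "e \<in> carrier A"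
    using x y by (simp_all add: m_def d_def e_def)
  have mx: "m \<preceq> x" and my: "m \<preceq> y"
    using x y by (simp_all add: m_def meet_lower1 meet_lower2)
  have xd: "d \<oplus> m = x" and ye: "e \<oplus> m = y"
    using x y mx my by (simp_all add: d_def e_def minus_plus_cancel)
  have disj: "v = \<zero>\<^sub>A" if "v \<in> carrier A" "v \<preceq> d" "v \<preceq> e" for v
    using minus_disjoint [of x y v] that x y by (simp add: d_def e_def m_def)
  have dm: "d \<preceq> \<sim> m" using x by (simp add: d_def minus_le_iff plus_neg)
  have xm: "x \<preceq> \<sim> m"
    using x mx orth orthogonal_mono [of m x x] orthogonal_sym [of m x] by simp
  have "x \<oplus> m \<preceq> x \<oplus> x"
    using x mx by (intro plus_mono) auto
  then have "(d \<oplus> m) \<oplus> m \<preceq> y \<oplus> y"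
    unfolding xd using le_trans [of "x \<oplus> m" "x \<oplus> x" "y \<oplus> y"] le x y by simp
  moreover have "y \<oplus> y = ((e \<oplus> e) \<oplus> m) \<oplus> m"
    unfolding ye [symmetric] by (simp add: plus_ac)
  ultimately have "d \<oplus> m \<preceq> (e \<oplus> e) \<oplus> m"
    using x xm plus_le_cancel [of "d \<oplus> m" "(e \<oplus> e) \<oplus> m" m] xd by simp
  then have dle: "d \<preceq> e \<oplus> e"
    using dm plus_le_cancel [of d "e \<oplus> e" m] by simp
  have "d \<preceq> e"
    by (rule disjoint_plus [OF cl(2) cl(3) cl(3) cl(2) _ le_refl [OF cl(2)] dle]) (rule disj)
  then have "d = \<zero>\<^sub>A"
    by (rule disj [OF cl(2) le_refl [OF cl(2)]])
  then have "x = m" using xd zero_plus [OF cl(1)] by simp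
  then show ?thesis using my by simp
qed

end

section \<open>Midpoints in DMV-algebras\<close>

context dmv_algebra
begin

definition half :: "'a \<Rightarrow> 'a" where
  "half x = mv_delta A 2 x"

definition avg :: "'a \<Rightarrow> 'a \<Rightarrow> 'a" where
  "avg x y = half x \<oplus> half y"

definition mid :: 'a where
  "mid = half \<one>\<^sub>A"

lemma half_closed [simp]: "x \<in> carrier A \<Longrightarrow> half x \<in> carrier A"
  by (simp add: half_def delta_closed)

lemma avg_closed [simp]: "\<lbrakk>x \<in> carrier A; y \<in> carrier A\<rbrakk> \<Longrightarrow> avg x y \<in> carrier A"
  by (simp add: avg_def)

lemma mid_closed [simp]: "mid \<in> carrier A"
  by (simp add: mid_def)

lemma half_plus_half: "x \<in> carrier A \<Longrightarrow> half x \<oplus> half x = x"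
  using D1 [of 2 x] half_closed [of x]
  by (simp add: half_def numeral_2_eq_2 zero_plus)

lemma half_orthogonal: "x \<in> carrier A \<Longrightarrow> half x \<preceq> \<sim> half x"
proof -
  assume x: "x \<in> carrier A"
  then have "mv_neg A (\<sim> half x \<oplus> \<sim> half x) = \<zero>\<^sub>A"
    using D2 [of 2 x] half_closed [of x] by (simp add: half_def mv_times_def zero_plus)
  then show ?thesis
    using x neg_neg [of "\<sim> half x \<oplus> \<sim> half x"] by (simp add: mv_le_def neg_zero)
qed

lemma half_le_iff: 
  assumes "x \<in> carrier A" "y \<in> carrier A"
  shows "half x \<preceq> half y \<longleftrightarrow> x \<preceq> y"
proof
  assume "half x \<preceq> half y"
  then have "half x \<oplus> half x \<preceq> half y \<oplus> half y"
    using assms by (simp add: plus_mono)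
  then show "x \<preceq> y" using assms by (simp add: half_plus_half)
next
  assume "x \<preceq> y"
  then show "half x \<preceq> half y"
    using assms double_le_cancel [of "half x" "half y"]
    by (simp add: half_orthogonal half_plus_half)
qed

lemma half_double:
  assumes "x \<in> carrier A" "x \<preceq> \<sim> x"
  shows "half (x \<oplus> x) = x"
proof (rule le_antisym)
  show "half (x \<oplus> x) \<preceq> x"
    using assms double_le_cancel [of "half (x \<oplus> x)" x]
    by (simp add: half_orthogonal half_plus_half)
  show "x \<preceq> half (x \<oplus> x)"
    using assms double_le_cancel [of x "half (x \<oplus> x)"] by (simp add: half_plus_half)
qed (use assms in simp_all)

text \<open>By uniqueness of halves it is enough that \<open>half x \<oplus> half y\<close> doubles to \<open>x \<oplus> y\<close> and is
  orthogonal to itself; the latter is the interchange of the four summands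
  \<open>half x, half x, half y, half y\<close>.\<close>
lemma half_plus:
  assumes "x \<in> carrier A" "y \<in> carrier A" "x \<preceq> \<sim> y"
  shows "half (x \<oplus> y) = half x \<oplus> half y"
proof -
  have dbl: "(half x \<oplus> half y) \<oplus> (half x \<oplus> half y) = x \<oplus> y"
  proof -
    have "(half x \<oplus> half y) \<oplus> (half x \<oplus> half y) = (half x \<oplus> half x) \<oplus> (half y \<oplus> half y)"
      using assms(1,2) by (simp add: plus_ac)
    then show ?thesis using assms by (simp add: half_plus_half)
  qed
  have "half x \<oplus> half y \<preceq> \<sim> (half x \<oplus> half y)"
    using assms orthogonal_interchange [of "half x" "half x" "half y" "half y"]
    by (simp add: half_orthogonal half_plus_half)
  then show ?thesis
    using half_double [of "half x \<oplus> half y"] assms(1,2) dbl by simp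
qed

lemma half_zero: "half \<zero>\<^sub>A = \<zero>\<^sub>A"
  using half_double [of "\<zero>\<^sub>A"] by (simp add: plus_zero)

lemma mid_plus_mid: "mid \<oplus> mid = \<one>\<^sub>A"
  by (simp add: mid_def half_plus_half)

lemma neg_mid: "\<sim> mid = mid"
proof (rule le_antisym)
  show "\<sim> mid \<preceq> mid" by (simp add: mv_le_def mid_plus_mid)
  show "mid \<preceq> \<sim> mid" by (simp add: mid_def half_orthogonal)
qed simp_all

lemma half_le_mid: "x \<in> carrier A \<Longrightarrow> half x \<preceq> mid"
  by (simp add: mid_def half_le_iff)

lemma le_mid_orthogonal:
  assumes "x \<in> carrier A" "y \<in> carrier A" "x \<preceq> mid" "y \<preceq> mid"
  shows "x \<preceq> \<sim> y"
proof (rule le_trans [of _ mid])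
  show "mid \<preceq> \<sim> y" using assms neg_le_neg_iff [of mid y] by (simp add: neg_mid)
qed (use assms in simp_all)

lemma halves_orthogonal: "\<lbrakk>x \<in> carrier A; y \<in> carrier A\<rbrakk> \<Longrightarrow> half x \<preceq> \<sim> half y"
  by (simp add: le_mid_orthogonal half_le_mid)

text \<open>The halves are exactly the elements below \<open>mid\<close>.\<close>
lemma half_surj: "\<lbrakk>z \<in> carrier A; z \<preceq> mid\<rbrakk> \<Longrightarrow> half (z \<oplus> z) = z"
  by (simp add: half_double le_mid_orthogonal)

lemma avg_comm: "\<lbrakk>x \<in> carrier A; y \<in> carrier A\<rbrakk> \<Longrightarrow> avg x y = avg y x"
  by (simp add: avg_def plus_comm)

lemma avg_idem: "x \<in> carrier A \<Longrightarrow> avg x x = x"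
  by (simp add: avg_def half_plus_half)

text \<open>Both sides are the untruncated sum of the four quarters.\<close>
lemma avg_medial:
  assumes "a \<in> carrier A" "b \<in> carrier A" "c \<in> carrier A" "d \<in> carrier A"
  shows "avg (avg a b) (avg c d) = avg (avg a c) (avg b d)"
  using assms by (simp add: avg_def half_plus halves_orthogonal plus_ac)

lemma avg_le_cancel:
  assumes "a \<in> carrier A" "b \<in> carrier A" "c \<in> carrier A"
  shows "avg a c \<preceq> avg b c \<longleftrightarrow> a \<preceq> b"
proof
  assume "avg a c \<preceq> avg b c"
  then have "half a \<preceq> half b"
    using assms plus_le_cancel [of "half a" "half b" "half c"]
    by (simp add: avg_def halves_orthogonal)
  then show "a \<preceq> b" using assms by (simp add: half_le_iff)
next
  assume "a \<preceq> b"
  then show "avg a c \<preceq> avg b c"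
    using assms by (simp add: avg_def plus_mono_left half_le_iff)
qed

lemma avg_neg: "x \<in> carrier A \<Longrightarrow> avg x (\<sim> x) = mid"
  using half_plus [of x "\<sim> x"] by (simp add: avg_def mid_def plus_neg)

lemma avg_zero: "x \<in> carrier A \<Longrightarrow> avg x \<zero>\<^sub>A = half x"
  by (simp add: avg_def half_zero plus_zero)

lemma avg_one_zero: "avg \<one>\<^sub>A \<zero>\<^sub>A = mid"
  by (simp add: avg_zero mid_def)

text \<open>The map \<open>avg _ c\<close> is onto the interval between the images of \<open>0\<close> and \<open>1\<close>: such an \<open>x\<close>
  exceeds \<open>half c\<close> by at most \<open>mid\<close>, and everything below \<open>mid\<close> is a half.\<close>
lemma avg_interval:
  assumes "c \<in> carrier A" "x \<in> carrier A" "avg \<zero>\<^sub>A c \<preceq> x" "x \<preceq> avg \<one>\<^sub>A c"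
  obtains y where "y \<in> carrier A" "x = avg y c"
proof
  let ?z = "x \<ominus> half c"
  have c: "half c \<preceq> x"
    using assms avg_comm [of c "\<zero>\<^sub>A"] by (simp add: avg_zero)
  have "?z \<preceq> mid"
    using assms by (simp add: minus_le_iff avg_def mid_def plus_comm)
  then have "half (?z \<oplus> ?z) = ?z"
    using assms by (simp add: half_surj)
  then show "x = avg (?z \<oplus> ?z) c"
    using assms c by (simp add: avg_def minus_plus_cancel)
qed (use assms in simp_all)

text \<open>The rule \<open>min (1, x + y) / 2 = min (1/2, (x + y)/2)\<close>; both sides have the double \<open>x \<oplus> y\<close>.
  It is the only place where the truncated sum of arbitrary elements has to be understood.\<close>
lemma half_plus_truncated:
  assumes "x \<in> carrier A" "y \<in> carrier A"
  shows "half (x \<oplus> y) = mv_meet A mid (avg x y)"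
proof (rule le_antisym)
  have "avg x y \<oplus> avg x y = (half x \<oplus> half x) \<oplus> (half y \<oplus> half y)"
    using assms by (simp add: avg_def plus_ac)
  then have dbl: "avg x y \<oplus> avg x y = x \<oplus> y"
    using assms by (simp add: half_plus_half)
  have "half (x \<oplus> y) \<preceq> avg x y"
    using assms double_le_cancel [of "half (x \<oplus> y)" "avg x y"] dbl
    by (simp add: half_orthogonal half_plus_half)
  then show "half (x \<oplus> y) \<preceq> mv_meet A mid (avg x y)"
    using assms by (simp add: meet_greatest half_le_mid)
  let ?z = "mv_meet A mid (avg x y)"
  have z: "?z \<in> carrier A" "?z \<preceq> avg x y" "?z \<preceq> mid"
    using assms by (simp_all add: meet_lower1 meet_lower2)
  then have "?z \<oplus> ?z \<preceq> x \<oplus> y"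
    using assms plus_mono [of ?z "avg x y" ?z "avg x y"] by (simp add: dbl)
  then show "?z \<preceq> half (x \<oplus> y)"
    using assms z double_le_cancel [of ?z "half (x \<oplus> y)"]
    by (simp add: half_plus_half le_mid_orthogonal)
qed (use assms in simp_all)

text \<open>The meet of \<open>avg x c\<close> and \<open>avg y c\<close> lies between \<open>avg 0 c\<close> and \<open>avg 1 c\<close>, so it has the
  form \<open>avg v c\<close> by \<open>avg_interval\<close>, and \<open>v\<close> must lie below \<open>x\<close> and \<open>y\<close>.\<close>
lemma avg_meet:
  assumes [simp]: "x \<in> carrier A" "y \<in> carrier A" "c \<in> carrier A"
  shows "mv_meet A (avg x c) (avg y c) = avg (mv_meet A x y) c"
proof (rule le_antisym)
  let ?w = "mv_meet A (avg x c) (avg y c)"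
  have w: "?w \<preceq> avg x c" "?w \<preceq> avg y c"
    by (simp_all add: meet_lower1 meet_lower2)
  have "avg \<zero>\<^sub>A c \<preceq> ?w"
    by (rule meet_greatest) (simp_all add: avg_le_cancel)
  moreover have "?w \<preceq> avg \<one>\<^sub>A c"
    using w(1) le_trans [of ?w "avg x c" "avg \<one>\<^sub>A c"] by (simp add: avg_le_cancel)
  ultimately obtain v where v: "v \<in> carrier A" "?w = avg v c"
    using avg_interval [of c ?w] by auto
  then show "?w \<preceq> avg (mv_meet A x y) c"
    using w by (simp add: avg_le_cancel meet_greatest)
  show "avg (mv_meet A x y) c \<preceq> ?w"
    by (rule meet_greatest) (simp_all add: avg_le_cancel meet_lower1 meet_lower2)
qed simp_all

lemma avg_join:
  assumes [simp]: "x \<in> carrier A" "y \<in> carrier A" "c \<in> carrier A"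
  shows "mv_join A (avg x c) (avg y c) = avg (mv_join A x y) c"
proof (rule le_antisym)
  let ?w = "mv_join A (avg x c) (avg y c)"
  have w: "avg x c \<preceq> ?w" "avg y c \<preceq> ?w"
    by (simp_all add: join_upper1 join_upper2)
  have "?w \<preceq> avg \<one>\<^sub>A c"
    by (rule join_least) (simp_all add: avg_le_cancel)
  moreover have "avg \<zero>\<^sub>A c \<preceq> ?w"
    using w(1) le_trans [of "avg \<zero>\<^sub>A c" "avg x c" ?w] by (simp add: avg_le_cancel)
  ultimately obtain v where v: "v \<in> carrier A" "?w = avg v c"
    using avg_interval [of c ?w] by auto
  then show "avg (mv_join A x y) c \<preceq> ?w"
    using w by (simp add: avg_le_cancel join_least)
  show "?w \<preceq> avg (mv_join A x y) c"
    by (rule join_least) (simp_all add: avg_le_cancel join_upper1 join_upper2)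
qed simp_all

end

section \<open>Lattice-ordered groups\<close>

lemma carrier_lg_order [simp]: "carrier (lg_order G) = carrier G"
  and le_lg_order [simp]: "le (lg_order G) = lg_le G"
  and eq_lg_order [simp]: "eq (lg_order G) = (=)"
  by (simp_all add: lg_order_def)

lemma (in group) mult_inv_cancel:
  assumes "x \<in> carrier G" "y \<in> carrier G"
  shows "inv x \<otimes> (x \<otimes> y) = y" "x \<otimes> (inv x \<otimes> y) = y"
  using assms by (simp_all add: m_assoc [symmetric])

context l_group
begin

abbreviation gle (infix "\<lesssim>" 50) where "x \<lesssim> y \<equiv> lg_le G x y"

lemma gle_refl [simp]: "x \<in> carrier G \<Longrightarrow> x \<lesssim> x"
proof -
  interpret L: lattice "lg_order G" by (rule lattice_order)
  show "x \<in> carrier G \<Longrightarrow> x \<lesssim> x" using L.le_refl [of x] by simp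
qed

lemma gle_antisym: "\<lbrakk>x \<lesssim> y; y \<lesssim> x; x \<in> carrier G; y \<in> carrier G\<rbrakk> \<Longrightarrow> x = y"
proof -
  interpret L: lattice "lg_order G" by (rule lattice_order)
  show "\<lbrakk>x \<lesssim> y; y \<lesssim> x; x \<in> carrier G; y \<in> carrier G\<rbrakk> \<Longrightarrow> x = y"
    using L.le_antisym [of x y] by simp
qed

lemma gle_trans:
  "\<lbrakk>x \<lesssim> y; y \<lesssim> z; x \<in> carrier G; y \<in> carrier G; z \<in> carrier G\<rbrakk> \<Longrightarrow> x \<lesssim> z"
proof -
  interpret L: lattice "lg_order G" by (rule lattice_order)
  show "\<lbrakk>x \<lesssim> y; y \<lesssim> z; x \<in> carrier G; y \<in> carrier G; z \<in> carrier G\<rbrakk> \<Longrightarrow> x \<lesssim> z"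
    using L.le_trans [of x y z] by simp
qed

lemma
  assumes "x \<in> carrier G" "y \<in> carrier G"
  shows gmeet_closed [simp]: "lg_meet G x y \<in> carrier G"
    and gmeet_lower1: "lg_meet G x y \<lesssim> x"
    and gmeet_lower2: "lg_meet G x y \<lesssim> y"
    and gmeet_greatest: "\<lbrakk>z \<in> carrier G; z \<lesssim> x; z \<lesssim> y\<rbrakk> \<Longrightarrow> z \<lesssim> lg_meet G x y"
    and gjoin_closed [simp]: "lg_join G x y \<in> carrier G"
    and gjoin_upper1: "x \<lesssim> lg_join G x y"
    and gjoin_upper2: "y \<lesssim> lg_join G x y"
    and gjoin_least: "\<lbrakk>z \<in> carrier G; x \<lesssim> z; y \<lesssim> z\<rbrakk> \<Longrightarrow> lg_join G x y \<lesssim> z"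
proof -
  interpret L: lattice "lg_order G" by (rule lattice_order)
  show "lg_meet G x y \<in> carrier G" "lg_meet G x y \<lesssim> x" "lg_meet G x y \<lesssim> y"
    using assms L.meet_closed [of x y] L.meet_left [of x y] L.meet_right [of x y] by simp_all
  show "\<lbrakk>z \<in> carrier G; z \<lesssim> x; z \<lesssim> y\<rbrakk> \<Longrightarrow> z \<lesssim> lg_meet G x y"
    using assms L.meet_le [of z x y] by simp
  show "lg_join G x y \<in> carrier G" "x \<lesssim> lg_join G x y" "y \<lesssim> lg_join G x y"
    using assms L.join_closed [of x y] L.join_left [of x y] L.join_right [of x y] by simp_all
  show "\<lbrakk>z \<in> carrier G; x \<lesssim> z; y \<lesssim> z\<rbrakk> \<Longrightarrow> lg_join G x y \<lesssim> z"
    using assms L.join_le [of x z y] by simp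
qed

lemma gmeet_eqI:
  assumes "x \<in> carrier G" "y \<in> carrier G" "m \<in> carrier G" "m \<lesssim> x" "m \<lesssim> y"
    and "\<And>z. \<lbrakk>z \<in> carrier G; z \<lesssim> x; z \<lesssim> y\<rbrakk> \<Longrightarrow> z \<lesssim> m"
  shows "lg_meet G x y = m"
proof (rule gle_antisym)
  show "lg_meet G x y \<lesssim> m"
    using assms(1,2) by (intro assms(6)) (simp_all add: gmeet_lower1 gmeet_lower2)
  show "m \<lesssim> lg_meet G x y"
    using assms(1-5) by (simp add: gmeet_greatest)
qed (use assms(1-3) in simp_all)

lemma gjoin_eqI:
  assumes "x \<in> carrier G" "y \<in> carrier G" "m \<in> carrier G" "x \<lesssim> m" "y \<lesssim> m"
    and "\<And>z. \<lbrakk>z \<in> carrier G; x \<lesssim> z; y \<lesssim> z\<rbrakk> \<Longrightarrow> m \<lesssim> z"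
  shows "lg_join G x y = m"
proof (rule gle_antisym)
  show "m \<lesssim> lg_join G x y"
    using assms(1,2) by (intro assms(6)) (simp_all add: gjoin_upper1 gjoin_upper2)
  show "lg_join G x y \<lesssim> m"
    using assms(1-5) by (simp add: gjoin_least)
qed (use assms(1-3) in simp_all)

lemma mult_left_mono:
  assumes "a \<in> carrier G" "b \<in> carrier G" "c \<in> carrier G" "a \<lesssim> b"
  shows "c \<otimes> a \<lesssim> c \<otimes> b"
proof -
  have "lg_meet G a b = a" using assms by (intro gmeet_eqI) simp_all
  then have "c \<otimes> a = lg_meet G (c \<otimes> a) (c \<otimes> b)"
    using assms mult_meet_distrib [of a b c] by simp
  then show ?thesis using assms gmeet_lower2 [of "c \<otimes> a" "c \<otimes> b"] by simp
qed

lemma mult_left_le_iff: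
  assumes "a \<in> carrier G" "b \<in> carrier G" "c \<in> carrier G"
  shows "c \<otimes> a \<lesssim> c \<otimes> b \<longleftrightarrow> a \<lesssim> b"
proof
  assume "c \<otimes> a \<lesssim> c \<otimes> b"
  then have "inv c \<otimes> (c \<otimes> a) \<lesssim> inv c \<otimes> (c \<otimes> b)"
    using assms mult_left_mono [of "c \<otimes> a" "c \<otimes> b" "inv c"] by simp
  then show "a \<lesssim> b" using assms by (simp add: mult_inv_cancel)
qed (use assms mult_left_mono in simp)

lemma mult_right_le_iff:
  assumes "a \<in> carrier G" "b \<in> carrier G" "c \<in> carrier G"
  shows "a \<otimes> c \<lesssim> b \<otimes> c \<longleftrightarrow> a \<lesssim> b"
  using mult_left_le_iff [OF assms] assms by (simp add: m_comm)

lemma mult_mono: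
  assumes "a \<in> carrier G" "b \<in> carrier G" "c \<in> carrier G" "d \<in> carrier G" "a \<lesssim> b" "c \<lesssim> d"
  shows "a \<otimes> c \<lesssim> b \<otimes> d"
  using assms gle_trans [of "a \<otimes> c" "b \<otimes> c" "b \<otimes> d"]
  by (simp add: mult_left_le_iff mult_right_le_iff)

text \<open>Let \<open>m\<close> be the meet of \<open>g\<close> and the unit. From \<open>1 \<le> g\<^sup>2\<close> one gets \<open>m \<le> g\<^sup>2\<close> and \<open>m \<le> g\<close>, whence
  \<open>m \<le> m g\<close>; trivially \<open>m \<le> m\<close>. Together these say \<open>m \<le> m\<^sup>2\<close>, so \<open>m\<close> is the unit.\<close>
lemma one_le_square_imp:
  assumes g: "g \<in> carrier G" and le: "\<one> \<lesssim> g \<otimes> g"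
  shows "\<one> \<lesssim> g"
proof -
  let ?m = "lg_meet G g \<one>"
  have m: "?m \<in> carrier G" "?m \<lesssim> g" "?m \<lesssim> \<one>"
    using g by (simp_all add: gmeet_lower1 gmeet_lower2)
  have "?m \<lesssim> g \<otimes> g"
    using g m le gle_trans [of ?m \<one> "g \<otimes> g"] by simp
  then have "?m \<lesssim> lg_meet G (g \<otimes> g) (g \<otimes> \<one>)"
    using g m by (intro gmeet_greatest) simp_all
  then have "?m \<lesssim> ?m \<otimes> g"
    using g m mult_meet_distrib [of g \<one> g] m_comm [of ?m g] by simp
  then have "?m \<lesssim> lg_meet G (?m \<otimes> g) (?m \<otimes> \<one>)"
    using g m by (intro gmeet_greatest) simp_all
  then have "?m \<otimes> \<one> \<lesssim> ?m \<otimes> ?m"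
    using g m mult_meet_distrib [of g \<one> ?m] by simp
  then have "\<one> \<lesssim> ?m"
    using m mult_left_le_iff [of \<one> ?m ?m] by simp
  then show ?thesis using g m gle_trans [of \<one> ?m g] by simp
qed

lemma square_mult:
  "\<lbrakk>x \<in> carrier G; y \<in> carrier G\<rbrakk> \<Longrightarrow> (x \<otimes> x) \<otimes> (y \<otimes> y) = (x \<otimes> y) \<otimes> (x \<otimes> y)"
  by (simp add: m_ac)

lemma square_le_iff:
  assumes x: "x \<in> carrier G" and y: "y \<in> carrier G"
  shows "x \<otimes> x \<lesssim> y \<otimes> y \<longleftrightarrow> x \<lesssim> y"
proof
  assume le: "x \<otimes> x \<lesssim> y \<otimes> y"
  let ?g = "inv x \<otimes> y"
  have "(x \<otimes> x) \<otimes> \<one> \<lesssim> (x \<otimes> x) \<otimes> (?g \<otimes> ?g)"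
  proof -
    have "(x \<otimes> x) \<otimes> (?g \<otimes> ?g) = (x \<otimes> ?g) \<otimes> (x \<otimes> ?g)"
      using square_mult [of x ?g] x y by simp
    also have "x \<otimes> ?g = y"
      using x y by (simp add: mult_inv_cancel)
    finally show ?thesis using x y le by simp
  qed
  then have "\<one> \<lesssim> ?g \<otimes> ?g"
    using x y mult_left_le_iff [of \<one> "?g \<otimes> ?g" "x \<otimes> x"] by simp
  then have "x \<otimes> \<one> \<lesssim> x \<otimes> ?g"
    using x y one_le_square_imp [of ?g] mult_left_mono [of \<one> ?g x] by simp
  then show "x \<lesssim> y" using x y by (simp add: mult_inv_cancel)
qed (use assms mult_mono in simp)

lemma pow_power_Suc: "x \<in> carrier G \<Longrightarrow> x [^] ((2::nat) ^ Suc n) = x [^] ((2::nat) ^ n) \<otimes> x [^] ((2::nat) ^ n)"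
  by (simp add: nat_pow_mult mult_2)

lemma pow_le_iff:
  assumes "x \<in> carrier G" "y \<in> carrier G"
  shows "x [^] ((2::nat) ^ n) \<lesssim> y [^] ((2::nat) ^ n) \<longleftrightarrow> x \<lesssim> y"
proof (induction n)
  case (Suc n)
  then show ?case
    using assms square_le_iff [of "x [^] ((2::nat) ^ n)" "y [^] ((2::nat) ^ n)"]
    by (simp only: pow_power_Suc nat_pow_closed)
qed (use assms in simp)

end

text \<open>The inverse of a translation is a translation, so monotone translations are order
  automorphisms and preserve meets.\<close>
lemma l_groupI:
  fixes G (structure)
  assumes "comm_group G" and "lattice (lg_order G)"
    and mono: "\<And>a b c. \<lbrakk>a \<in> carrier G; b \<in> carrier G; c \<in> carrier G; lg_le G a b\<rbrakk>
      \<Longrightarrow> lg_le G (c \<otimes> a) (c \<otimes> b)"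
  shows "l_group G"
proof -
  interpret comm_group G by fact
  interpret L: lattice "lg_order G" by fact
  show ?thesis
  proof (intro l_group.intro l_group_axioms.intro, fact, fact)
    fix a b c
    assume cl: "a \<in> carrier G" "b \<in> carrier G" "c \<in> carrier G"
    let ?m = "lg_meet G a b" and ?n = "lg_meet G (c \<otimes> a) (c \<otimes> b)"
    have m: "?m \<in> carrier G" "lg_le G ?m a" "lg_le G ?m b"
      using cl L.meet_closed [of a b] L.meet_left [of a b] L.meet_right [of a b] by simp_all
    have n: "?n \<in> carrier G" "lg_le G ?n (c \<otimes> a)" "lg_le G ?n (c \<otimes> b)"
      using cl L.meet_closed [of "c \<otimes> a" "c \<otimes> b"] L.meet_left [of "c \<otimes> a" "c \<otimes> b"]
        L.meet_right [of "c \<otimes> a" "c \<otimes> b"] by simp_all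
    have "lg_le G (inv c \<otimes> ?n) a" "lg_le G (inv c \<otimes> ?n) b"
      using cl n mono [of ?n "c \<otimes> a" "inv c"] mono [of ?n "c \<otimes> b" "inv c"]
      by (simp_all add: mult_inv_cancel)
    then have "lg_le G (inv c \<otimes> ?n) ?m"
      using cl n L.meet_le [of "inv c \<otimes> ?n" a b] by simp
    then have "lg_le G ?n (c \<otimes> ?m)"
      using cl n m mono [of "inv c \<otimes> ?n" ?m c] by (simp add: mult_inv_cancel)
    moreover have "lg_le G (c \<otimes> ?m) ?n"
      using cl m mono [of ?m a c] mono [of ?m b c]
        L.meet_le [of "c \<otimes> ?m" "c \<otimes> a" "c \<otimes> b"] by simp
    ultimately show "c \<otimes> ?m = ?n"
      using cl m n L.le_antisym [of "c \<otimes> ?m" ?n] by simp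
  qed
qed

section \<open>Dyadic coordinates\<close>

context dmv_algebra
begin

text \<open>The change of coordinates from level \<open>n\<close> to level \<open>n + k\<close>: contraction towards the
  midpoint by the factor \<open>2^k\<close>.\<close>
definition contract :: "nat \<Rightarrow> 'a \<Rightarrow> 'a" where
  "contract k = (\<lambda>x. avg x mid) ^^ k"

lemma contract_0 [simp]: "contract 0 x = x"
  by (simp add: contract_def)

lemma contract_Suc: "contract (Suc k) x = avg (contract k x) mid"
  by (simp add: contract_def)

lemma contract_closed [simp]: "x \<in> carrier A \<Longrightarrow> contract k x \<in> carrier A"
  by (induction k) (simp_all add: contract_Suc)

lemma contract_contract: "contract j (contract k x) = contract (j + k) x"
  by (simp add: contract_def funpow_add)

lemma contract_le_iff:
  "\<lbrakk>x \<in> carrier A; y \<in> carrier A\<rbrakk> \<Longrightarrow> contract k x \<preceq> contract k y \<longleftrightarrow> x \<preceq> y"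
  by (induction k) (simp_all add: contract_Suc avg_le_cancel)

lemma contract_eq_iff:
  assumes "x \<in> carrier A" "y \<in> carrier A"
  shows "contract k x = contract k y \<longleftrightarrow> x = y"
  using assms le_antisym [of x y] le_refl [of "contract k x"] contract_le_iff [of x y k] contract_le_iff [of y x k]
  by auto

lemma contract_avg:
  assumes "x \<in> carrier A" "y \<in> carrier A"
  shows "contract k (avg x y) = avg (contract k x) (contract k y)"
proof (induction k)
  case (Suc k)
  have "avg (avg (contract k x) (contract k y)) (avg mid mid)
      = avg (avg (contract k x) mid) (avg (contract k y) mid)"
    using assms by (simp add: avg_medial)
  then show ?case by (simp add: Suc contract_Suc avg_idem)
qed simp

lemma contract_meet:
  "\<lbrakk>x \<in> carrier A; y \<in> carrier A\<rbrakk> \<Longrightarrow>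
    mv_meet A (contract k x) (contract k y) = contract k (mv_meet A x y)"
  by (induction k) (simp_all add: contract_Suc avg_meet)

lemma contract_join:
  "\<lbrakk>x \<in> carrier A; y \<in> carrier A\<rbrakk> \<Longrightarrow>
    mv_join A (contract k x) (contract k y) = contract k (mv_join A x y)"
  by (induction k) (simp_all add: contract_Suc avg_join)

lemma contract_mid [simp]: "contract k mid = mid"
  by (induction k) (simp_all add: contract_Suc avg_idem)

lemma contract_interval:
  assumes "x \<in> carrier A" "contract k \<zero>\<^sub>A \<preceq> x" "x \<preceq> contract k \<one>\<^sub>A"
  obtains y where "y \<in> carrier A" "x = contract k y"
proof -
  have "\<exists>y\<in>carrier A. x = contract k y" using assms
  proof (induction k arbitrary: x)
    case (Suc k)
    have "avg \<zero>\<^sub>A mid \<preceq> x"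
      using Suc.prems le_trans [of "avg \<zero>\<^sub>A mid" "avg (contract k \<zero>\<^sub>A) mid" x]
      by (simp add: contract_Suc avg_le_cancel)
    moreover have "x \<preceq> avg \<one>\<^sub>A mid"
      using Suc.prems le_trans [of x "avg (contract k \<one>\<^sub>A) mid" "avg \<one>\<^sub>A mid"]
      by (simp add: contract_Suc avg_le_cancel)
    ultimately obtain z where z: "z \<in> carrier A" "x = avg z mid"
      using Suc.prems(1) avg_interval [of mid x] by auto
    then obtain y where "y \<in> carrier A" "z = contract k y"
      using Suc.prems Suc.IH [of z] by (auto simp: contract_Suc avg_le_cancel)
    then show ?case using z(2) by (auto simp: contract_Suc)
  qed auto
  then show thesis using that by blast
qed

end

text \<open>Coordinates on an ordered group: \<open>e n x\<close> is to be thought of as \<open>2^n (2x - u)\<close>, where \<open>u\<close> is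
  the unit \<open>e 0 1\<close>. The group laws follow from these rules once the neutral element is
  the midpoint, and this is how they are established for the direct limit.\<close>
locale dyadic_coordinates = dmv_algebra A for A :: "('a, 'm) dmv_scheme" (structure) +
  fixes G :: "('b, 'k) lgroup_scheme" and e :: "nat \<Rightarrow> 'a \<Rightarrow> 'b"
  assumes carrier_eq: "carrier G = {e n x | n x. x \<in> carrier A}"
    and refine: "x \<in> carrier A \<Longrightarrow> e (Suc n) (avg x mid) = e n x"
    and e_mult: "\<lbrakk>x \<in> carrier A; y \<in> carrier A\<rbrakk> \<Longrightarrow> e n x \<otimes>\<^bsub>G\<^esub> e n y = e (Suc n) (avg x y)"
    and e_le: "\<lbrakk>x \<in> carrier A; y \<in> carrier A\<rbrakk> \<Longrightarrow> lg_le G (e n x) (e n y) \<longleftrightarrow> x \<preceq> y"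
begin

lemma e_closed [simp]: "x \<in> carrier A \<Longrightarrow> e n x \<in> carrier G"
  using carrier_eq by blast

lemma e_cases:
  assumes "g \<in> carrier G"
  obtains n x where "x \<in> carrier A" "g = e n x"
  using assms carrier_eq by blast

lemma e_contract: "x \<in> carrier A \<Longrightarrow> e (k + n) (contract k x) = e n x"
  by (induction k) (simp_all add: contract_Suc refine)

lemma e_inj: "\<lbrakk>x \<in> carrier A; y \<in> carrier A\<rbrakk> \<Longrightarrow> e n x = e n y \<longleftrightarrow> x = y"
  by (metis e_le le_antisym le_refl)

text \<open>Whether two pairs denote the same element depends on the algebra only. This is the reason
  why coordinates determine the group.\<close>
lemma e_eq_iff:
  assumes "x \<in> carrier A" "y \<in> carrier A"
  shows "e n x = e m y \<longleftrightarrow> contract m x = contract n y"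
  using assms e_contract [of x m n] e_contract [of y n m] e_inj [of "contract m x" "contract n y" "n + m"]
  by (simp add: add.commute)

text \<open>Finitely many elements can be written at one level, where the rules for products and order
  apply.\<close>
lemma common_level:
  assumes "a \<in> carrier G" "b \<in> carrier G"
  obtains n x y where "x \<in> carrier A" "y \<in> carrier A" "a = e n x" "b = e n y"
proof -
  obtain n x where x: "x \<in> carrier A" "a = e n x" using assms(1) by (rule e_cases)
  obtain m y where y: "y \<in> carrier A" "b = e m y" using assms(2) by (rule e_cases)
  show thesis
  proof
    show "a = e (m + n) (contract m x)" using x by (simp add: e_contract)
    show "b = e (m + n) (contract n y)" using y e_contract [of y n m] by (simp add: add.commute)
  qed (use x y in simp_all)
qed

lemma common_level3:
  assumes "a \<in> carrier G" "b \<in> carrier G" "c \<in> carrier G"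
  obtains n x y z where "x \<in> carrier A" "y \<in> carrier A" "z \<in> carrier A"
    "a = e n x" "b = e n y" "c = e n z"
proof -
  obtain n x y where x: "x \<in> carrier A" "y \<in> carrier A" "a = e n x" "b = e n y"
    using assms(1,2) by (rule common_level)
  obtain m z where z: "z \<in> carrier A" "c = e m z" using assms(3) by (rule e_cases)
  show thesis
  proof
    show "a = e (m + n) (contract m x)" "b = e (m + n) (contract m y)"
      using x by (simp_all add: e_contract)
    show "c = e (m + n) (contract n z)" using z e_contract [of z n m] by (simp add: add.commute)
  qed (use x z in simp_all)
qed

end

lemma order_iso_imp_lattice_iso:
  assumes "l_group G" "l_group H" and bij: "bij_betw f (carrier G) (carrier H)"
    and le: "\<And>a b. \<lbrakk>a \<in> carrier G; b \<in> carrier G\<rbrakk> \<Longrightarrow> lg_le H (f a) (f b) \<longleftrightarrow> lg_le G a b"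
    and a: "a \<in> carrier G" and b: "b \<in> carrier G"
  shows "f (lg_meet G a b) = lg_meet H (f a) (f b)"
    and "f (lg_join G a b) = lg_join H (f a) (f b)"
proof -
  interpret G: l_group G by fact
  interpret H: l_group H by fact
  have cl: "f x \<in> carrier H" if "x \<in> carrier G" for x
    using bij that by (auto simp: bij_betw_def)
  have sur: "\<exists>x\<in>carrier G. z = f x" if "z \<in> carrier H" for z
    using bij that by (auto simp: bij_betw_def)
  have "lg_meet H (f a) (f b) = f (lg_meet G a b)"
  proof (rule H.gmeet_eqI)
    fix z assume "z \<in> carrier H" and z: "lg_le H z (f a)" "lg_le H z (f b)"
    then obtain x where "x \<in> carrier G" "z = f x" using sur by blast
    then show "lg_le H z (f (lg_meet G a b))"
      using z a b by (simp add: le G.gmeet_greatest)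
  qed (use a b in \<open>simp_all add: cl le G.gmeet_lower1 G.gmeet_lower2\<close>)
  then show "f (lg_meet G a b) = lg_meet H (f a) (f b)" by simp
  have "lg_join H (f a) (f b) = f (lg_join G a b)"
  proof (rule H.gjoin_eqI)
    fix z assume "z \<in> carrier H" and z: "lg_le H (f a) z" "lg_le H (f b) z"
    then obtain x where "x \<in> carrier G" "z = f x" using sur by blast
    then show "lg_le H (f (lg_join G a b)) z"
      using z a b by (simp add: le G.gjoin_least)
  qed (use a b in \<open>simp_all add: cl le G.gjoin_upper1 G.gjoin_upper2\<close>)
  then show "f (lg_join G a b) = lg_join H (f a) (f b)" by simp
qed

text \<open>The isomorphism is \<open>e n x \<mapsto> e' n x\<close>, well defined by \<open>e_eq_iff\<close> on both sides.\<close>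
lemma dyadic_coordinates_unique:
  assumes "dyadic_coordinates A G e" "dyadic_coordinates A H e'" "l_group G" "l_group H"
  shows "\<exists>f\<in>lg_iso G H. \<forall>n. \<forall>x\<in>carrier A. f (e n x) = e' n x"
proof -
  interpret G: dyadic_coordinates A G e by fact
  interpret H: dyadic_coordinates A H e' by fact
  have "\<exists>h. \<forall>n. \<forall>x\<in>carrier A. g = e n x \<longrightarrow> h = e' n x" for g
  proof (cases "g \<in> carrier G")
    case True
    then obtain m y where "y \<in> carrier A" "g = e m y" by (rule G.e_cases)
    then have "\<forall>n. \<forall>x\<in>carrier A. g = e n x \<longrightarrow> e' m y = e' n x"
      by (simp add: G.e_eq_iff H.e_eq_iff)
    then show ?thesis by blast
  next
    case False
    then show ?thesis using G.e_closed by blast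
  qed
  then obtain f where "\<And>g n x. x \<in> carrier A \<Longrightarrow> g = e n x \<Longrightarrow> f g = e' n x"
    by metis
  then have f: "f (e n x) = e' n x" if "x \<in> carrier A" for n x
    using that by blast
  have le: "lg_le H (f a) (f b) \<longleftrightarrow> lg_le G a b" if ab: "a \<in> carrier G" "b \<in> carrier G" for a b
    by (rule G.common_level [OF ab]) (simp add: f G.e_le H.e_le)
  have mult: "f (a \<otimes>\<^bsub>G\<^esub> b) = f a \<otimes>\<^bsub>H\<^esub> f b" if ab: "a \<in> carrier G" "b \<in> carrier G" for a b
    by (rule G.common_level [OF ab]) (simp add: f G.e_mult H.e_mult)
  have inj: "a = b" if ab: "a \<in> carrier G" "b \<in> carrier G" and eq: "f a = f b" for a b
    using eq by (rule_tac G.common_level [OF ab]) (simp add: f G.e_inj H.e_inj)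
  have bij: "bij_betw f (carrier G) (carrier H)"
  proof (rule bij_betw_imageI)
    show "inj_on f (carrier G)" using inj by (rule inj_onI)
    show "f ` carrier G = carrier H"
      unfolding G.carrier_eq H.carrier_eq by (force simp: f image_def)
  qed
  have "f \<in> iso G H"
    using bij mult by (auto simp: iso_def hom_def bij_betw_def)
  then have "f \<in> lg_iso G H"
    using order_iso_imp_lattice_iso [OF assms(3,4) bij le] by (simp add: lg_iso_def)
  then show ?thesis using f by blast
qed

section \<open>Dyadic coordinates on every enveloping group\<close>

text \<open>Let \<open>\<phi>\<close> identify \<open>A\<close> with the interval of \<open>G\<close>. In additive notation the coordinates are
  \<open>e n x = 2^n c x\<close> with \<open>c x = 2 \<phi> x - u\<close>. Everything follows from the identity
  \<open>2 c (avg x y) = c x + c y\<close> and the torsion-freeness of \<open>G\<close>, except surjectivity: a given \<open>g\<close> lies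
  between \<open>-2^n u\<close> and \<open>2^n u\<close> for some \<open>n\<close>, and by divisibility \<open>g = 2^n y\<close> and \<open>y + u = 2z\<close> with
  \<open>z\<close> in the interval.\<close>
lemma (in dmv_algebra) enveloping_dyadic:
  fixes G :: "('b, 'k) lgroup_scheme"
  assumes env: "enveloping_divisible_l_group A G u"
  obtains e where "dyadic_coordinates A G e" "e 0 \<one>\<^sub>A = u"
proof -
  interpret G: divisible_l_group G
    using env by (simp add: enveloping_divisible_l_group_def)
  from env have "strong_unit G u"
    by (simp add: enveloping_divisible_l_group_def)
  then have u [simp]: "u \<in> carrier G"
    and strong: "\<And>x. x \<in> carrier G \<Longrightarrow> \<exists>n::nat. lg_le G x (u [^]\<^bsub>G\<^esub> n)"
    by (auto simp: strong_unit_def)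
  obtain \<phi> where "\<phi> \<in> mv_iso (mv_reduct A) (Gamma G u)"
    using env by (auto simp: enveloping_divisible_l_group_def)
  then have bij: "bij_betw \<phi> (carrier A) {x \<in> carrier G. lg_le G \<one>\<^bsub>G\<^esub> x \<and> lg_le G x u}"
    and plus: "\<And>x y. \<lbrakk>x \<in> carrier A; y \<in> carrier A\<rbrakk> \<Longrightarrow> \<phi> (x \<oplus> y) = lg_meet G u (\<phi> x \<otimes>\<^bsub>G\<^esub> \<phi> y)"
    and neg: "\<And>x. x \<in> carrier A \<Longrightarrow> \<phi> (\<sim> x) = u \<otimes>\<^bsub>G\<^esub> inv\<^bsub>G\<^esub> \<phi> x"
    and one: "\<phi> \<one>\<^sub>A = u"
    by (simp_all add: mv_iso_def mv_reduct_def mv.truncate_def Gamma_def)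
  have in_G [simp]: "\<phi> x \<in> carrier G" and ge1: "lg_le G \<one>\<^bsub>G\<^esub> (\<phi> x)"
    if "x \<in> carrier A" for x
    using bij that by (auto simp: bij_betw_def)
  have inj: "\<phi> x = \<phi> y \<longleftrightarrow> x = y" if "x \<in> carrier A" "y \<in> carrier A" for x y
    using bij that by (auto simp: bij_betw_def inj_on_def)
  have surj: "\<exists>x\<in>carrier A. z = \<phi> x"
    if "z \<in> carrier G" "lg_le G \<one>\<^bsub>G\<^esub> z" "lg_le G z u" for z
  proof -
    have "z \<in> \<phi> ` carrier A" using bij that by (simp add: bij_betw_def)
    then show ?thesis by blast
  qed
  \<comment> \<open>Comparability is an equation in both structures: \<open>\<sim> x \<oplus> y\<close> is truncated to \<open>1\<close> exactly when
    \<open>u \<le> u - \<phi> x + \<phi> y\<close>.\<close>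
  have le: "lg_le G (\<phi> x) (\<phi> y) \<longleftrightarrow> x \<preceq> y" if xy [simp]: "x \<in> carrier A" "y \<in> carrier A" for x y
  proof -
    let ?c = "u \<otimes>\<^bsub>G\<^esub> inv\<^bsub>G\<^esub> \<phi> x"
    have "?c \<otimes>\<^bsub>G\<^esub> \<phi> x = u" by (simp add: G.m_assoc)
    then have "lg_le G (\<phi> x) (\<phi> y) \<longleftrightarrow> lg_le G u (?c \<otimes>\<^bsub>G\<^esub> \<phi> y)"
      using G.mult_left_le_iff [of "\<phi> x" "\<phi> y" ?c] by simp
    also have "\<dots> \<longleftrightarrow> lg_meet G u (?c \<otimes>\<^bsub>G\<^esub> \<phi> y) = u"
    proof
      assume "lg_le G u (?c \<otimes>\<^bsub>G\<^esub> \<phi> y)"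
      then show "lg_meet G u (?c \<otimes>\<^bsub>G\<^esub> \<phi> y) = u"
        by (intro G.gmeet_eqI) simp_all
    next
      assume "lg_meet G u (?c \<otimes>\<^bsub>G\<^esub> \<phi> y) = u"
      then show "lg_le G u (?c \<otimes>\<^bsub>G\<^esub> \<phi> y)"
        using G.gmeet_lower2 [of u "?c \<otimes>\<^bsub>G\<^esub> \<phi> y"] by simp
    qed
    also have "\<dots> \<longleftrightarrow> \<phi> (\<sim> x \<oplus> y) = \<phi> \<one>\<^sub>A"
      by (simp add: plus neg one)
    also have "\<dots> \<longleftrightarrow> x \<preceq> y"
      by (simp add: inj mv_le_def)
    finally show ?thesis .
  qed
  have add: "\<phi> (x \<oplus> y) = \<phi> x \<otimes>\<^bsub>G\<^esub> \<phi> y"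
    if xy [simp]: "x \<in> carrier A" "y \<in> carrier A" and orth: "x \<preceq> \<sim> y" for x y
  proof -
    have "lg_le G (\<phi> x) (u \<otimes>\<^bsub>G\<^esub> inv\<^bsub>G\<^esub> \<phi> y)"
      using orth le [of x "\<sim> y"] by (simp add: neg)
    then have "lg_le G (\<phi> x \<otimes>\<^bsub>G\<^esub> \<phi> y) ((u \<otimes>\<^bsub>G\<^esub> inv\<^bsub>G\<^esub> \<phi> y) \<otimes>\<^bsub>G\<^esub> \<phi> y)"
      by (simp add: G.mult_right_le_iff)
    then have "lg_meet G u (\<phi> x \<otimes>\<^bsub>G\<^esub> \<phi> y) = \<phi> x \<otimes>\<^bsub>G\<^esub> \<phi> y"
      by (intro G.gmeet_eqI) (simp_all add: G.m_assoc)
    then show ?thesis by (simp add: plus)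
  qed
  define c where "c x = (\<phi> x \<otimes>\<^bsub>G\<^esub> \<phi> x) \<otimes>\<^bsub>G\<^esub> inv\<^bsub>G\<^esub> u" for x
  have c_closed [simp]: "c x \<in> carrier G" if "x \<in> carrier A" for x
    using that by (simp add: c_def)
  have c_le: "lg_le G (c x) (c y) \<longleftrightarrow> x \<preceq> y" if "x \<in> carrier A" "y \<in> carrier A" for x y
    using that by (simp add: c_def G.mult_right_le_iff G.square_le_iff le)
  have c_avg: "c (avg x y) \<otimes>\<^bsub>G\<^esub> c (avg x y) = c x \<otimes>\<^bsub>G\<^esub> c y"
    if xy: "x \<in> carrier A" "y \<in> carrier A" for x y
  proof -
    have dbl: "\<phi> z = \<phi> (half z) \<otimes>\<^bsub>G\<^esub> \<phi> (half z)" if "z \<in> carrier A" for z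
      using that add [of "half z" "half z"] by (simp add: half_orthogonal half_plus_half)
    have "\<phi> (avg x y) = \<phi> (half x) \<otimes>\<^bsub>G\<^esub> \<phi> (half y)"
      using xy by (simp add: avg_def add halves_orthogonal)
    then show ?thesis
      using xy by (simp add: c_def dbl [OF xy(1)] dbl [OF xy(2)] G.m_ac)
  qed
  have c_mid: "c mid = \<one>\<^bsub>G\<^esub>"
  proof -
    have "\<phi> mid \<otimes>\<^bsub>G\<^esub> \<phi> mid = u"
      using add [of mid mid] by (simp add: neg_mid mid_plus_mid one)
    then show ?thesis by (simp add: c_def)
  qed
  define e where "e n x = c x [^]\<^bsub>G\<^esub> ((2::nat) ^ n)" for n x
  have e_mult: "e n x \<otimes>\<^bsub>G\<^esub> e n y = e (Suc n) (avg x y)"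
    if "x \<in> carrier A" "y \<in> carrier A" for n x y
    using that unfolding e_def G.pow_power_Suc [OF c_closed [OF avg_closed [OF that]]]
    by (simp add: G.nat_pow_distrib [symmetric] c_avg)
  have "dyadic_coordinates A G e"
  proof
    show "e (Suc n) (avg x mid) = e n x" if "x \<in> carrier A" for n x
      using that e_mult [of x mid n] by (simp add: e_def c_mid)
    show "lg_le G (e n x) (e n y) \<longleftrightarrow> x \<preceq> y" if "x \<in> carrier A" "y \<in> carrier A" for n x y
      using that by (simp add: e_def G.pow_le_iff c_le)
    show "carrier G = {e n x |n x. x \<in> carrier A}"
    proof
      show "{e n x |n x. x \<in> carrier A} \<subseteq> carrier G" by (auto simp: e_def)
      show "carrier G \<subseteq> {e n x |n x. x \<in> carrier A}"
      proof
        fix g assume g [simp]: "g \<in> carrier G"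
        have u1: "lg_le G \<one>\<^bsub>G\<^esub> u" using ge1 [of "\<one>\<^sub>A"] by (simp add: one)
        have u_pow: "lg_le G (u [^]\<^bsub>G\<^esub> i) (u [^]\<^bsub>G\<^esub> (i + j))" for i j :: nat
        proof (induction j)
          case (Suc j)
          have "lg_le G (u [^]\<^bsub>G\<^esub> (i + j) \<otimes>\<^bsub>G\<^esub> \<one>\<^bsub>G\<^esub>) (u [^]\<^bsub>G\<^esub> (i + j) \<otimes>\<^bsub>G\<^esub> u)"
            using u1 by (intro G.mult_left_mono) simp_all
          then show ?case
            using Suc G.gle_trans [of "u [^]\<^bsub>G\<^esub> i" "u [^]\<^bsub>G\<^esub> (i + j)" "u [^]\<^bsub>G\<^esub> (i + Suc j)"] by simp
        qed simp
        obtain i where i: "lg_le G g (u [^]\<^bsub>G\<^esub> (i::nat))" using strong [of g] by auto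
        obtain j where j: "lg_le G (inv\<^bsub>G\<^esub> g) (u [^]\<^bsub>G\<^esub> (j::nat))" using strong [of "inv\<^bsub>G\<^esub> g"] by auto
        \<comment> \<open>Any \<open>n\<close> with \<open>i, j \<le> 2^n\<close> would do.\<close>
        define n where "n = i + j"
        have bound: "lg_le G (u [^]\<^bsub>G\<^esub> k) (u [^]\<^bsub>G\<^esub> ((2::nat) ^ n))" if "k \<le> n" for k
        proof -
          have "k \<le> 2 ^ n" using that less_exp [of n] by linarith
          then show ?thesis using u_pow [of k "2 ^ n - k"] by simp
        qed
        obtain y where y [simp]: "y \<in> carrier G" and yg: "y [^]\<^bsub>G\<^esub> ((2::nat) ^ n) = g"
          using G.divisible [of g "2 ^ n"] by auto
        have "lg_le G (y [^]\<^bsub>G\<^esub> ((2::nat) ^ n)) (u [^]\<^bsub>G\<^esub> ((2::nat) ^ n))"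
          unfolding yg using i bound [of i]
            G.gle_trans [of g "u [^]\<^bsub>G\<^esub> i" "u [^]\<^bsub>G\<^esub> ((2::nat) ^ n)"] by (simp add: n_def)
        then have yu: "lg_le G y u" by (simp add: G.pow_le_iff)
        have "lg_le G ((inv\<^bsub>G\<^esub> y) [^]\<^bsub>G\<^esub> ((2::nat) ^ n)) (u [^]\<^bsub>G\<^esub> ((2::nat) ^ n))"
          unfolding G.nat_pow_inv [OF y] yg
          using j bound [of j]
            G.gle_trans [of "inv\<^bsub>G\<^esub> g" "u [^]\<^bsub>G\<^esub> j" "u [^]\<^bsub>G\<^esub> ((2::nat) ^ n)"] by (simp add: n_def)
        then have "lg_le G (inv\<^bsub>G\<^esub> y) u" by (simp add: G.pow_le_iff)
        then have yu': "lg_le G \<one>\<^bsub>G\<^esub> (y \<otimes>\<^bsub>G\<^esub> u)"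
          using G.mult_left_mono [of "inv\<^bsub>G\<^esub> y" u y] by simp
        obtain z where z [simp]: "z \<in> carrier G" and "z [^]\<^bsub>G\<^esub> (2::nat) = y \<otimes>\<^bsub>G\<^esub> u"
          using G.divisible [of "y \<otimes>\<^bsub>G\<^esub> u" 2] by auto
        then have zz: "z \<otimes>\<^bsub>G\<^esub> z = y \<otimes>\<^bsub>G\<^esub> u" by (simp add: numeral_2_eq_2)
        have "lg_le G \<one>\<^bsub>G\<^esub> z"
          using yu' G.one_le_square_imp [of z] by (simp add: zz)
        moreover have "lg_le G z u"
          using yu G.square_le_iff [of z u] by (simp add: zz G.mult_right_le_iff)
        ultimately obtain x where x: "x \<in> carrier A" "z = \<phi> x" using surj [of z] by auto
        have "c x = y" using zz by (simp add: c_def x(2) [symmetric] G.m_assoc)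
        then have "g = e n x" by (simp add: e_def yg)
        then show "g \<in> {e n x |n x. x \<in> carrier A}" using x(1) by blast
      qed
    qed
  qed (simp_all add: e_mult)
  moreover have "e 0 \<one>\<^sub>A = u"
    by (simp add: e_def c_def one G.m_assoc)
  ultimately show thesis by (rule that)
qed

section \<open>Groups with dyadic coordinates are enveloping groups\<close>

text \<open>The middle of \<open>A\<close> has the value \<open>2 (u/2) - u = 0\<close>. With this as the neutral element, \<open>G\<close>
  is shown to be an enveloping group of \<open>A\<close>.\<close>
locale dyadic_group = dyadic_coordinates A G e
  for A :: "('a, 'm) dmv_scheme" (structure) and G :: "('b, 'k) lgroup_scheme" and e +
  assumes one_eq: "\<one>\<^bsub>G\<^esub> = e 0 mid"
begin

lemma e_mid: "e n mid = \<one>\<^bsub>G\<^esub>"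
  using e_contract [of mid n 0] by (simp add: one_eq)

lemma e_double: "x \<in> carrier A \<Longrightarrow> e (Suc n) x = e n x \<otimes>\<^bsub>G\<^esub> e n x"
  by (simp add: e_mult avg_idem)

lemma comm_group: "comm_group G"
proof (rule comm_groupI)
  fix a b assume ab: "a \<in> carrier G" "b \<in> carrier G"
  show "a \<otimes>\<^bsub>G\<^esub> b \<in> carrier G"
    by (rule common_level [OF ab]) (simp add: e_mult)
  show "a \<otimes>\<^bsub>G\<^esub> b = b \<otimes>\<^bsub>G\<^esub> a"
    by (rule common_level [OF ab]) (simp add: e_mult avg_comm)
next
  fix a b c assume abc: "a \<in> carrier G" "b \<in> carrier G" "c \<in> carrier G"
  obtain n x y z where *: "x \<in> carrier A" "y \<in> carrier A" "z \<in> carrier A"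
    "a = e n x" "b = e n y" "c = e n z"
    using abc by (rule common_level3)
  \<comment> \<open>The outer factor is first moved up one level, where it acquires the coordinate \<open>avg mid z\<close>
    or \<open>avg x mid\<close>; associativity then is mediality.\<close>
  have "(a \<otimes>\<^bsub>G\<^esub> b) \<otimes>\<^bsub>G\<^esub> c = e (Suc n) (avg x y) \<otimes>\<^bsub>G\<^esub> e (Suc n) (avg mid z)"
    using * refine [of z n] by (simp add: e_mult avg_comm [of z mid])
  also have "\<dots> = e (Suc (Suc n)) (avg (avg x y) (avg mid z))"
    using * by (simp add: e_mult)
  also have "\<dots> = e (Suc (Suc n)) (avg (avg x mid) (avg y z))"
    using * avg_medial [of x y mid z] by simp
  also have "\<dots> = e (Suc n) (avg x mid) \<otimes>\<^bsub>G\<^esub> e (Suc n) (avg y z)"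
    using * by (simp add: e_mult)
  also have "\<dots> = a \<otimes>\<^bsub>G\<^esub> (b \<otimes>\<^bsub>G\<^esub> c)"
    using * refine [of x n] by (simp add: e_mult)
  finally show "(a \<otimes>\<^bsub>G\<^esub> b) \<otimes>\<^bsub>G\<^esub> c = a \<otimes>\<^bsub>G\<^esub> (b \<otimes>\<^bsub>G\<^esub> c)" .
next
  fix a assume "a \<in> carrier G"
  then obtain n x where x: "x \<in> carrier A" "a = e n x" by (rule e_cases)
  then show "\<one>\<^bsub>G\<^esub> \<otimes>\<^bsub>G\<^esub> a = a"
    using e_mult [of mid x n] refine [of x n] by (simp add: e_mid avg_comm)
  have "e n (\<sim> x) \<otimes>\<^bsub>G\<^esub> a = \<one>\<^bsub>G\<^esub>"
    using x by (simp add: e_mult avg_comm [of "\<sim> x" x] avg_neg e_mid)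
  then show "\<exists>b\<in>carrier G. b \<otimes>\<^bsub>G\<^esub> a = \<one>\<^bsub>G\<^esub>"
    using x by (intro bexI [of _ "e n (\<sim> x)"]) simp_all
qed (simp add: one_eq)

text \<open>A lower bound may live at a finer level than \<open>x\<close> and \<open>y\<close>; it stays below their meet because
  contractions preserve meets.\<close>
lemma e_meet_greatest:
  assumes [simp]: "x \<in> carrier A" "y \<in> carrier A"
    and "g \<in> carrier G" "lg_le G g (e n x)" "lg_le G g (e n y)"
  shows "lg_le G g (e n (mv_meet A x y))"
proof -
  obtain m w where w: "w \<in> carrier A" "g = e m w" using assms(3) by (rule e_cases)
  have lift: "e n z = e (n + m) (contract m z)" if "z \<in> carrier A" for z
    using that e_contract [of z m n] by (simp add: add.commute)
  have "g = e (n + m) (contract n w)" using w by (simp add: e_contract)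
  then show ?thesis
    using assms(4,5) w(1) meet_greatest [of "contract m x" "contract m y" "contract n w"]
    by (simp add: lift e_le contract_meet)
qed

lemma e_join_least:
  assumes [simp]: "x \<in> carrier A" "y \<in> carrier A"
    and "g \<in> carrier G" "lg_le G (e n x) g" "lg_le G (e n y) g"
  shows "lg_le G (e n (mv_join A x y)) g"
proof -
  obtain m w where w: "w \<in> carrier A" "g = e m w" using assms(3) by (rule e_cases)
  have lift: "e n z = e (n + m) (contract m z)" if "z \<in> carrier A" for z
    using that e_contract [of z m n] by (simp add: add.commute)
  have "g = e (n + m) (contract n w)" using w by (simp add: e_contract)
  then show ?thesis
    using assms(4,5) w(1) join_least [of "contract m x" "contract m y" "contract n w"]
    by (simp add: lift e_le contract_join)
qed

lemma lattice: "lattice (lg_order G)"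
proof -
  have po: "partial_order (lg_order G)"
  proof (unfold_locales, simp_all)
    fix a assume "a \<in> carrier G"
    then show "lg_le G a a" by (rule e_cases) (simp add: e_le)
  next
    fix a b assume "lg_le G a b" "lg_le G b a" and ab: "a \<in> carrier G" "b \<in> carrier G"
    then show "a = b"
      by (rule_tac common_level [OF ab]) (simp add: e_le e_inj le_antisym)
  next
    fix a b c
    assume le: "lg_le G a b" "lg_le G b c" and abc: "a \<in> carrier G" "b \<in> carrier G" "c \<in> carrier G"
    obtain n x y z where "x \<in> carrier A" "y \<in> carrier A" "z \<in> carrier A"
      "a = e n x" "b = e n y" "c = e n z"
      using abc by (rule common_level3)
    then show "lg_le G a c" using le le_trans [of x y z] by (simp add: e_le)
  qed
  interpret partial_order "lg_order G" by (rule po)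
  show ?thesis
  proof
    fix a b assume "a \<in> carrier (lg_order G)" "b \<in> carrier (lg_order G)"
    then have ab: "a \<in> carrier G" "b \<in> carrier G" by simp_all
    obtain n x y where *: "x \<in> carrier A" "y \<in> carrier A" "a = e n x" "b = e n y"
      using ab by (rule common_level)
    have "least (lg_order G) (e n (mv_join A x y)) (Upper (lg_order G) {a, b})"
      using * by (intro least_UpperI)
        (auto simp: Upper_def e_le join_upper1 join_upper2 intro: e_join_least)
    then show "\<exists>s. least (lg_order G) s (Upper (lg_order G) {a, b})" by blast
    have "greatest (lg_order G) (e n (mv_meet A x y)) (Lower (lg_order G) {a, b})"
      using * by (intro greatest_LowerI)
        (auto simp: Lower_def e_le meet_lower1 meet_lower2 intro: e_meet_greatest)
    then show "\<exists>s. greatest (lg_order G) s (Lower (lg_order G) {a, b})" by blast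
  qed
qed

lemma l_group: "l_group G"
proof (rule l_groupI [OF comm_group lattice])
  fix a b c
  assume abc: "a \<in> carrier G" "b \<in> carrier G" "c \<in> carrier G" and le: "lg_le G a b"
  obtain n x y z where "x \<in> carrier A" "y \<in> carrier A" "z \<in> carrier A"
    "a = e n x" "b = e n y" "c = e n z"
    using abc by (rule common_level3)
  then show "lg_le G (c \<otimes>\<^bsub>G\<^esub> a) (c \<otimes>\<^bsub>G\<^esub> b)"
    using le by (simp add: e_mult e_le avg_comm [of z] avg_le_cancel)
qed

end

sublocale dyadic_group \<subseteq> G: l_group G
  by (rule l_group)

context dyadic_group
begin

lemma e_meet: "\<lbrakk>x \<in> carrier A; y \<in> carrier A\<rbrakk> \<Longrightarrow> lg_meet G (e n x) (e n y) = e n (mv_meet A x y)"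
  by (rule G.gmeet_eqI) (simp_all add: e_le meet_lower1 meet_lower2 e_meet_greatest)

lemma e_eq_pow: "x \<in> carrier A \<Longrightarrow> e n x = e 0 x [^]\<^bsub>G\<^esub> ((2::nat) ^ n)"
  by (induction n) (simp_all add: e_double G.pow_power_Suc del: power_Suc)

abbreviation u where "u \<equiv> e 0 \<one>\<^sub>A"

lemma strong_unit: "strong_unit G u"
  unfolding strong_unit_def
proof (intro conjI ballI)
  fix g assume "g \<in> carrier G"
  then obtain n x where "x \<in> carrier A" "g = e n x" by (rule e_cases)
  then have "lg_le G g (u [^]\<^bsub>G\<^esub> ((2::nat) ^ n))"
    by (simp add: e_eq_pow [symmetric] e_le)
  then show "\<exists>n::nat. lg_le G g (u [^]\<^bsub>G\<^esub> n)" by blast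
qed simp

text \<open>The element \<open>a\<close> of the interval has the coordinate \<open>(a + u)/2\<close> at level 0, since
  \<open>2 (a + u)/2 - u = a\<close>.\<close>
definition embed :: "'a \<Rightarrow> 'b" where
  "embed a = e 0 (avg a \<one>\<^sub>A)"

lemma embed_closed [simp]: "a \<in> carrier A \<Longrightarrow> embed a \<in> carrier G"
  by (simp add: embed_def)

lemma embed_one: "embed \<one>\<^sub>A = u"
  by (simp add: embed_def avg_idem)

lemma embed_zero: "embed \<zero>\<^sub>A = \<one>\<^bsub>G\<^esub>"
  by (simp add: embed_def avg_comm [of "\<zero>\<^sub>A"] avg_one_zero one_eq)

text \<open>At level 1, where sums of two embedded elements are computed, \<open>a\<close> has the coordinate
  \<open>(a/2 + u)/2\<close>.\<close>
lemma embed_level_1: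
  assumes "a \<in> carrier A"
  shows "embed a = e 1 (avg (half a) \<one>\<^sub>A)"
proof -
  have "embed a = e 1 (avg (avg a \<one>\<^sub>A) (avg \<zero>\<^sub>A \<one>\<^sub>A))"
    using assms refine [of "avg a \<one>\<^sub>A" 0]
    by (simp add: embed_def avg_comm [of "\<zero>\<^sub>A"] avg_one_zero)
  then show ?thesis
    using assms avg_medial [of a "\<one>\<^sub>A" "\<zero>\<^sub>A" "\<one>\<^sub>A"] by (simp add: avg_zero avg_idem)
qed

lemma embed_mult:
  assumes "a \<in> carrier A" "b \<in> carrier A"
  shows "embed a \<otimes>\<^bsub>G\<^esub> embed b = e 1 (avg (avg a b) \<one>\<^sub>A)"
  using assms avg_medial [of a "\<one>\<^sub>A" b "\<one>\<^sub>A"] by (simp add: embed_def e_mult avg_idem)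

lemma embed_plus:
  assumes "a \<in> carrier A" "b \<in> carrier A"
  shows "embed (a \<oplus> b) = lg_meet G u (embed a \<otimes>\<^bsub>G\<^esub> embed b)"
proof -
  have "lg_meet G u (embed a \<otimes>\<^bsub>G\<^esub> embed b)
      = lg_meet G (e 1 (avg mid \<one>\<^sub>A)) (e 1 (avg (avg a b) \<one>\<^sub>A))"
    using assms embed_level_1 [of "\<one>\<^sub>A"] by (simp add: embed_mult embed_one mid_def)
  also have "\<dots> = e 1 (avg (half (a \<oplus> b)) \<one>\<^sub>A)"
    using assms by (simp add: e_meet avg_meet half_plus_truncated)
  also have "\<dots> = embed (a \<oplus> b)"
    using assms by (simp add: embed_level_1)
  finally show ?thesis by simp
qed

lemma embed_plus_orthogonal:
  assumes "a \<in> carrier A" "b \<in> carrier A" "a \<preceq> \<sim> b"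
  shows "embed (a \<oplus> b) = embed a \<otimes>\<^bsub>G\<^esub> embed b"
  using assms embed_level_1 [of "a \<oplus> b"] by (simp add: embed_mult half_plus avg_def [of a b])

lemma embed_neg:
  assumes a: "a \<in> carrier A"
  shows "embed (\<sim> a) = u \<otimes>\<^bsub>G\<^esub> inv\<^bsub>G\<^esub> embed a"
proof -
  have "embed (\<sim> a) \<otimes>\<^bsub>G\<^esub> embed a = u"
    using a embed_plus_orthogonal [of "\<sim> a" a] by (simp add: neg_plus embed_one)
  then have "u \<otimes>\<^bsub>G\<^esub> inv\<^bsub>G\<^esub> embed a = embed (\<sim> a) \<otimes>\<^bsub>G\<^esub> embed a \<otimes>\<^bsub>G\<^esub> inv\<^bsub>G\<^esub> embed a" by simp
  then show ?thesis using a by (simp add: G.m_assoc)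
qed

text \<open>The second axiom for \<open>\<delta>\<^sub>n\<close> says that none of the partial sums leading from \<open>\<delta>\<^sub>n x\<close> to
  \<open>n.\<delta>\<^sub>n x = x\<close> is truncated, so they are sums in \<open>G\<close>.\<close>
lemma embed_multiple:
  assumes n: "1 \<le> n" and x: "x \<in> carrier A"
  shows "embed (mv_delta A n x) [^]\<^bsub>G\<^esub> n = embed x"
proof -
  let ?d = "mv_delta A n x"
  have d [simp]: "?d \<in> carrier A" using n x by (rule delta_closed)
  have mult [simp]: "mv_multiple A k ?d \<in> carrier A" for k
    by (induction k) simp_all
  have "?d \<preceq> \<sim> mv_multiple A (n - 1) ?d"
    using D2 [OF n x] neg_neg [of "\<sim> ?d \<oplus> \<sim> mv_multiple A (n - 1) ?d"]
    by (simp add: mv_times_def mv_le_def neg_zero)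
  then have top: "mv_multiple A (n - 1) ?d \<preceq> \<sim> ?d"
    by (rule orthogonal_sym) simp_all
  have mono: "mv_multiple A k ?d \<preceq> mv_multiple A (k + j) ?d" for k j
  proof (induction j)
    case (Suc j)
    then show ?case
      using le_trans [of "mv_multiple A k ?d" "mv_multiple A (k + j) ?d" "mv_multiple A (k + Suc j) ?d"]
      by simp
  qed simp
  have "embed (mv_multiple A k ?d) = embed ?d [^]\<^bsub>G\<^esub> k" if "k \<le> n" for k
    using that
  proof (induction k)
    case (Suc k)
    have "mv_multiple A k ?d \<preceq> \<sim> ?d"
      using orthogonal_mono [of "mv_multiple A k ?d" "mv_multiple A (n - 1) ?d" ?d] top
        mono [of k "n - 1 - k"] Suc.prems by simp
    then show ?case
      using Suc by (simp add: embed_plus_orthogonal)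
  qed (simp add: embed_zero)
  from this [of n] show ?thesis using D1 [OF n x] by simp
qed

text \<open>In additive notation every element is \<open>2^n (2 x - u)\<close> with \<open>x\<close> and \<open>u\<close> embedded from \<open>A\<close>, and
  \<open>\<delta>\<^sub>m\<close> divides both by \<open>m\<close>.\<close>
lemma divisible:
  assumes g: "g \<in> carrier G" and m: "1 \<le> (m::nat)"
  shows "\<exists>y\<in>carrier G. y [^]\<^bsub>G\<^esub> m = g"
proof -
  obtain n x where x [simp]: "x \<in> carrier A" and gx: "g = e n x" using g by (rule e_cases)
  have "embed x \<otimes>\<^bsub>G\<^esub> embed x = e 0 x \<otimes>\<^bsub>G\<^esub> u"
    by (simp add: e_mult embed_mult avg_idem)
  then have e0: "(embed x \<otimes>\<^bsub>G\<^esub> embed x) \<otimes>\<^bsub>G\<^esub> inv\<^bsub>G\<^esub> embed \<one>\<^sub>A = e 0 x"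
    by (simp add: embed_one G.m_assoc)
  define r where "r z = embed (mv_delta A m z)" for z
  have r [simp]: "r z \<in> carrier G" and r_pow: "r z [^]\<^bsub>G\<^esub> m = embed z" if "z \<in> carrier A" for z
    using that m by (simp_all add: r_def embed_multiple delta_closed)
  define y where "y = (r x \<otimes>\<^bsub>G\<^esub> r x) \<otimes>\<^bsub>G\<^esub> inv\<^bsub>G\<^esub> r \<one>\<^sub>A"
  have y: "y \<in> carrier G" by (simp add: y_def)
  have "y [^]\<^bsub>G\<^esub> m = e 0 x"
    by (simp add: y_def G.nat_pow_distrib G.nat_pow_inv r_pow e0)
  moreover have "(y [^]\<^bsub>G\<^esub> ((2::nat) ^ n)) [^]\<^bsub>G\<^esub> m = (y [^]\<^bsub>G\<^esub> m) [^]\<^bsub>G\<^esub> ((2::nat) ^ n)"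
    using y by (simp add: G.nat_pow_pow mult.commute)
  ultimately have "(y [^]\<^bsub>G\<^esub> ((2::nat) ^ n)) [^]\<^bsub>G\<^esub> m = g"
    by (simp add: gx e_eq_pow [of x n])
  then show ?thesis using y by blast
qed

lemma embed_inj: "\<lbrakk>a \<in> carrier A; b \<in> carrier A\<rbrakk> \<Longrightarrow> embed a = embed b \<Longrightarrow> a = b"
  using le_antisym [of a b] avg_le_cancel [of a b "\<one>\<^sub>A"] avg_le_cancel [of b a "\<one>\<^sub>A"]
  by (simp add: embed_def e_inj)

text \<open>An element \<open>e n x\<close> between \<open>0\<close> and \<open>u\<close> has \<open>x\<close> between the contractions of \<open>mid\<close> and \<open>1\<close>. By
  \<open>contract_interval\<close> it can be moved down to level 0, where its coordinate lies between \<open>mid\<close> and \<open>1\<close>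
  and hence has the form \<open>avg a 1\<close>.\<close>
lemma embed_image: "embed ` carrier A = {g \<in> carrier G. lg_le G \<one>\<^bsub>G\<^esub> g \<and> lg_le G g u}"
proof (intro equalityI subsetI)
  fix g assume "g \<in> embed ` carrier A"
  then obtain a where a: "a \<in> carrier A" "g = embed a" by blast
  have "mid = avg \<zero>\<^sub>A \<one>\<^sub>A" by (simp add: avg_comm [of "\<zero>\<^sub>A"] avg_one_zero)
  then have "mid \<preceq> avg a \<one>\<^sub>A" using a by (simp add: avg_le_cancel)
  then show "g \<in> {g \<in> carrier G. lg_le G \<one>\<^bsub>G\<^esub> g \<and> lg_le G g u}"
    using a by (simp add: embed_def one_eq e_le)
next
  fix g assume "g \<in> {g \<in> carrier G. lg_le G \<one>\<^bsub>G\<^esub> g \<and> lg_le G g u}"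
  then have g: "g \<in> carrier G" "lg_le G \<one>\<^bsub>G\<^esub> g" "lg_le G g u" by simp_all
  obtain n x where x: "x \<in> carrier A" "g = e n x" using g(1) by (rule e_cases)
  have lower: "contract n mid \<preceq> x"
    using g(2) x by (simp add: e_mid [of n, symmetric] e_le)
  have upper: "x \<preceq> contract n \<one>\<^sub>A"
    using g(3) x e_contract [of "\<one>\<^sub>A" n 0, symmetric] by (simp add: e_le)
  have "contract n \<zero>\<^sub>A \<preceq> contract n mid"
    by (subst contract_le_iff) simp_all
  then have "contract n \<zero>\<^sub>A \<preceq> x"
    using lower x(1) le_trans [of "contract n \<zero>\<^sub>A" mid x] by simp
  then obtain y where y: "y \<in> carrier A" "x = contract n y"
    using x(1) upper contract_interval by blast
  then have "mid \<preceq> y"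
    using lower contract_le_iff [of mid y n] by simp
  then obtain a where "a \<in> carrier A" "y = avg a \<one>\<^sub>A"
    using y(1) avg_interval [of "\<one>\<^sub>A" y]
    by (auto simp: avg_comm [of "\<zero>\<^sub>A"] avg_one_zero avg_idem)
  then have "g = embed a"
    using x y e_contract [of y n 0] by (simp add: embed_def)
  then show "g \<in> embed ` carrier A" using \<open>a \<in> carrier A\<close> by blast
qed

lemma enveloping: "enveloping_divisible_l_group A G u"
proof -
  have "divisible_l_group G"
    by (intro divisible_l_group.intro l_group divisible_l_group_axioms.intro divisible)
  moreover have "embed \<in> mv_iso (mv_reduct A) (Gamma G u)"
    using embed_image embed_inj
    by (simp add: mv_iso_def mv_reduct_def mv.truncate_def Gamma_def bij_betw_def inj_on_def
        embed_plus embed_neg embed_one embed_zero)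
  ultimately show ?thesis
    using strong_unit by (auto simp: enveloping_divisible_l_group_def)
qed

end

section \<open>The direct limit\<close>

context dmv_algebra
begin

text \<open>The class of the pair \<open>(n, x)\<close>: all pairs \<open>(m, y)\<close> that agree with it in the direct limit
  along the contraction. Each is recorded as a triple \<open>(m, y, \<sim> y)\<close>, which fits the reading
  \<open>2^m (y - \<sim> y)\<close> of its coordinates.\<close>
definition limit_class :: "nat \<Rightarrow> 'a \<Rightarrow> (nat \<times> 'a \<times> 'a) set" where
  "limit_class n x = {(m, y, \<sim> y) | m y. y \<in> carrier A \<and> contract n y = contract m x}"

lemma limit_class_contract: "x \<in> carrier A \<Longrightarrow> limit_class (k + n) (contract k x) = limit_class n x"
proof -
  assume x: "x \<in> carrier A"
  have "contract (k + n) y = contract m (contract k x) \<longleftrightarrow> contract n y = contract m x"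
    if "y \<in> carrier A" for m y
    using that x contract_eq_iff [of "contract n y" "contract m x" k]
    by (simp add: contract_contract add.commute)
  then show ?thesis by (auto simp: limit_class_def)
qed

lemma limit_class_inj: 
  assumes "x \<in> carrier A" "y \<in> carrier A" "limit_class n x = limit_class n y"
  shows "x = y"
proof -
  have "(n, x, \<sim> x) \<in> limit_class n x" using assms(1) by (simp add: limit_class_def)
  then have "(n, x, \<sim> x) \<in> limit_class n y" using assms(3) by simp
  then have "contract n x = contract n y" by (auto simp: limit_class_def)
  then show ?thesis using assms by (simp add: contract_eq_iff)
qed

lemma limit_class_common:
  assumes "x \<in> carrier A" "x' \<in> carrier A" "limit_class n x = limit_class m x'"
  shows "contract m x = contract n x'"
  using assms limit_class_contract [of x m n] limit_class_contract [of x' n m]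
    limit_class_inj [of "contract m x" "contract n x'" "n + m"] by (simp add: add.commute)

text \<open>Two classes are added at any level common to both; \<open>envelope_mult_limit_class\<close> shows that the
  result does not depend on the level.\<close>
definition envelope_mult :: "(nat \<times> 'a \<times> 'a) set \<Rightarrow> (nat \<times> 'a \<times> 'a) set \<Rightarrow> (nat \<times> 'a \<times> 'a) set" where
  "envelope_mult a b = (THE c. \<exists>n x y. x \<in> carrier A \<and> y \<in> carrier A \<and>
     a = limit_class n x \<and> b = limit_class n y \<and> c = limit_class (Suc n) (avg x y))"

definition envelope :: "(nat \<times> 'a \<times> 'a) set lgroup" where
  "envelope = \<lparr>carrier = {limit_class n x | n x. x \<in> carrier A},
     mult = envelope_mult,
     one = limit_class 0 mid,
     lg_le = (\<lambda>a b. \<exists>n x y. x \<in> carrier A \<and> y \<in> carrier A \<and> a = limit_class n x \<and> b = limit_class n y \<and> x \<preceq> y)\<rparr>"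

lemma envelope_mult_limit_class:
  assumes "x \<in> carrier A" "y \<in> carrier A"
  shows "envelope_mult (limit_class n x) (limit_class n y) = limit_class (Suc n) (avg x y)"
  unfolding envelope_mult_def
proof (rule the_equality)
  fix c
  assume "\<exists>m x' y'. x' \<in> carrier A \<and> y' \<in> carrier A \<and>
     limit_class n x = limit_class m x' \<and> limit_class n y = limit_class m y' \<and> c = limit_class (Suc m) (avg x' y')"
  then obtain m x' y' where *: "x' \<in> carrier A" "y' \<in> carrier A"
    "limit_class n x = limit_class m x'" "limit_class n y = limit_class m y'" "c = limit_class (Suc m) (avg x' y')" by blast
  have "contract m (avg x y) = contract n (avg x' y')"
    using * assms by (simp add: contract_avg limit_class_common [of x x' n m] limit_class_common [of y y' n m])
  then show "c = limit_class (Suc n) (avg x y)"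
    using * assms limit_class_contract [of "avg x y" m "Suc n"] limit_class_contract [of "avg x' y'" n "Suc m"]
    by (simp add: add.commute)
qed (use assms in blast)

lemma dyadic_group_envelope: "dyadic_group A envelope limit_class"
proof
  show "limit_class (Suc n) (avg x mid) = limit_class n x" if "x \<in> carrier A" for n x
    using that limit_class_contract [of x 1 n] by (simp add: contract_def)
  show "limit_class n x \<otimes>\<^bsub>envelope\<^esub> limit_class n y = limit_class (Suc n) (avg x y)"
    if "x \<in> carrier A" "y \<in> carrier A" for n x y
    using that by (simp add: envelope_def envelope_mult_limit_class)
  show "lg_le envelope (limit_class n x) (limit_class n y) \<longleftrightarrow> x \<preceq> y"
    if xy: "x \<in> carrier A" "y \<in> carrier A" for n x y
  proof
    assume "lg_le envelope (limit_class n x) (limit_class n y)"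
    then obtain m x' y' where *: "x' \<in> carrier A" "y' \<in> carrier A"
      "limit_class n x = limit_class m x'" "limit_class n y = limit_class m y'" "x' \<preceq> y'" by (auto simp: envelope_def)
    then have "contract m x \<preceq> contract m y"
      using xy limit_class_common [of x x' n m] limit_class_common [of y y' n m] by (simp add: contract_le_iff)
    then show "x \<preceq> y" using xy by (simp add: contract_le_iff)
  qed (use xy in \<open>auto simp: envelope_def\<close>)
qed (simp_all add: envelope_def)

end

theorem theorem3p12:
  fixes A :: "'a dmv"
  assumes "dmv_algebra A"
  shows "(\<exists>(G :: 'a envelope lgroup) u. enveloping_divisible_l_group A G u) \<and>
    (\<forall>(G :: 'b lgroup) u (H :: 'c lgroup) v.
      enveloping_divisible_l_group A G u \<and> enveloping_divisible_l_group A H v \<longrightarrow>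
      (\<exists>f \<in> lg_iso G H. f u = v))"
proof -
  interpret dmv_algebra A by fact
  show ?thesis
  proof (intro conjI allI impI)
    show "\<exists>(G :: 'a envelope lgroup) u. enveloping_divisible_l_group A G u"
    proof (intro exI)
      interpret E: dyadic_group A envelope limit_class
        by (rule dyadic_group_envelope)
      show "enveloping_divisible_l_group A envelope (limit_class 0 (mv_one A))"
        by (rule E.enveloping)
    qed
  next
    fix G :: "'b lgroup" and u and H :: "'c lgroup" and v
    assume env: "enveloping_divisible_l_group A G u \<and> enveloping_divisible_l_group A H v"
    obtain e where e: "dyadic_coordinates A G e" "e 0 (mv_one A) = u"
      by (rule enveloping_dyadic [OF conjunct1 [OF env]])
    obtain e' where e': "dyadic_coordinates A H e'" "e' 0 (mv_one A) = v"
      by (rule enveloping_dyadic [OF conjunct2 [OF env]])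
    have "l_group G" "l_group H"
      using env by (simp_all add: enveloping_divisible_l_group_def divisible_l_group_def)
    then obtain f where "f \<in> lg_iso G H" "\<forall>n. \<forall>x\<in>carrier A. f (e n x) = e' n x"
      using dyadic_coordinates_unique [OF e(1) e'(1)] by blast
    then show "\<exists>f\<in>lg_iso G H. f u = v"
      using e(2) e'(2) by blast
  qed
qed

end
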